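(* Let $\{\rho_\theta;\theta\in\Theta\}$, $\Theta\subset\mathbb R^m$, be a model as in the context, $\theta\in\Theta$, $\boldsymbol\delta=(\delta_1,\dots,\delta_m)$ with all $\delta_i\ne0$ and $\mathbf t=(t_1,\dots,t_m)\in[0,1]^m$ such that all points $\theta+t_i\delta_ie_i$ and $\theta-(1-t_i)\delta_ie_i$ lie in $\Theta$, and assume $J^{S,\mathbf t}_{\theta,\boldsymbol\delta}$ and $J^{R,\mathbf t}_{\theta,\boldsymbol\delta}$ are invertible. If $M$ is an unbiased estimator of $\theta$, then for every real positive definite $m\times m$ matrix $G$, \[ \mathrm{Sp}\,G V_\theta(M)\ge\mathrm{Sp}\,G(J^{S,\mathbf t}_{\theta,\boldsymbol\delta})^{-1},\qquad \mathrm{Sp}\,GV_\theta(M)\ge\mathrm{Sp}\,G(J^{R,\mathbf t}_{\theta,\boldsymbol\delta})^{-1}+\mathrm{Spabs}\,\mathrm{Im}\,G(J^{R,\mathbf t}_{\theta,\boldsymbol\delta})^{-1}. \]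
   Context: $\mathcal H$ is finite-dimensional; $\rho_\theta>0$ density operators on $\mathcal H$; $e_i$ is the $i$-th standard basis vector of $\mathbb R^m$. An estimator is a POVM $M$ on the Borel sets of $\mathbb R^m$; it is unbiased if $\int x_i\,\mathrm{Tr}(\rho_{\theta'}M(dx))=\theta'^i$ for all $i$ and all $\theta'\in\Theta$; $V_\theta(M)$ is the $m\times m$ matrix with entries $\int(x_i-\theta^i)(x_j-\theta^j)\mathrm{Tr}(\rho_\theta M(dx))$. $\Delta^t_{i,\delta}f(\theta)=\big(f(\theta+t\delta e_i)-f(\theta-(1-t)\delta e_i)\big)/\delta$. $L^{S,t}_{i,\theta,\delta}$ (Hermitian) and $L^{R,t}_{i,\theta,\delta}$ solve $\Delta^t_{i,\delta}\rho_\theta=\frac12(L^{S,t}_{i,\theta,\delta}\rho_\theta+\rho_\theta L^{S,t}_{i,\theta,\delta})=\rho_\theta L^{R,t}_{i,\theta,\delta}$. $J^{S,\mathbf t}_{\theta,\boldsymbol\delta,i,j}=\frac12\mathrm{Tr}\rho_\theta(L^{S,t_i}_{i,\theta,\delta_i}L^{S,t_j}_{j,\theta,\delta_j}+L^{S,t_j}_{j,\theta,\delta_j}L^{S,t_i}_{i,\theta,\delta_i})$ and $J^{R,\mathbf t}_{\theta,\boldsymbol\delta,i,j}=\mathrm{Tr}\rho_\theta L^{R,t_j}_{j,\theta,\delta_j}(L^{R,t_i}_{i,\theta,\delta_i})^\dagger$. $\mathrm{Sp}$ is the trace of an $m\times m$ matrix, $\mathrm{Im}$ the entrywise imaginary part,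 and $\mathrm{Spabs}\,A$ the sum of the absolute values of the eigenvalues of $A$. *)

theory Defs
  imports "HOL-Analysis.Analysis" "HOL-Computational_Algebra.Polynomial"
begin

definition adjoint_mat :: "complex^'d^'d \<Rightarrow> complex^'d^'d" where
  "adjoint_mat A = (\<chi> i j. cnj (A $ j $ i))"

definition hermitian_mat :: "complex^'d^'d \<Rightarrow> bool" where
  "hermitian_mat A \<longleftrightarrow> adjoint_mat A = A"

definition qform :: "complex^'d^'d \<Rightarrow> complex^'d \<Rightarrow> complex" where
  "qform A v = (\<Sum>i\<in>UNIV. \<Sum>j\<in>UNIV. cnj (v $ i) * A $ i $ j * v $ j)"

definition psd_mat :: "complex^'d^'d \<Rightarrow> bool" where
  "psd_mat A \<longleftrightarrow> hermitian_mat A \<and> (\<forall>v. 0 \<le> Re (qform A v))"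

definition pd_mat :: "complex^'d^'d \<Rightarrow> bool" where
  "pd_mat A \<longleftrightarrow> hermitian_mat A \<and> (\<forall>v. v \<noteq> 0 \<longrightarrow> 0 < Re (qform A v))"

definition density_op :: "complex^'d^'d \<Rightarrow> bool" where
  "density_op \<rho> \<longleftrightarrow> psd_mat \<rho> \<and> trace \<rho> = 1"

(* M is a POVM on the Borel sets: positive-operator valued, normalised,
   and countably additive (entrywise, equivalently weakly, in finite dimension) *)
definition povm :: "((real^'m) set \<Rightarrow> complex^'d^'d) \<Rightarrow> bool" where
  "povm M \<longleftrightarrow>
     (\<forall>A\<in>sets borel. psd_mat (M A)) \<and>
     M UNIV = mat 1 \<and>
     (\<forall>A::nat \<Rightarrow> (real^'m) set. range A \<subseteq> sets borel \<longrightarrow> disjoint_family A \<longrightarrow>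
        (\<forall>i j. (\<lambda>n. M (A n) $ i $ j) sums (M (\<Union>n. A n) $ i $ j)))"

definition outcome_measure :: "complex^'d^'d \<Rightarrow> ((real^'m) set \<Rightarrow> complex^'d^'d) \<Rightarrow> (real^'m) measure" where
  "outcome_measure \<rho> M = measure_of UNIV (sets borel) (\<lambda>A. ennreal (Re (trace (\<rho> ** M A))))"

definition unbiased :: "(real^'m \<Rightarrow> complex^'d^'d) \<Rightarrow> (real^'m) set \<Rightarrow> ((real^'m) set \<Rightarrow> complex^'d^'d) \<Rightarrow> bool" where
  "unbiased \<rho> \<Theta> M \<longleftrightarrow>
     (\<forall>\<theta>'\<in>\<Theta>. \<forall>i. integrable (outcome_measure (\<rho> \<theta>') M) (\<lambda>x. x $ i) \<and>
                   (\<integral>x. x $ i \<partial>outcome_measure (\<rho> \<theta>') M) = \<theta>' $ i)"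

definition cov_mat :: "(real^'m \<Rightarrow> complex^'d^'d) \<Rightarrow> real^'m \<Rightarrow> ((real^'m) set \<Rightarrow> complex^'d^'d) \<Rightarrow> real^'m^'m" where
  "cov_mat \<rho> \<theta> M = (\<chi> i j. \<integral>x. (x $ i - \<theta> $ i) * (x $ j - \<theta> $ j) \<partial>outcome_measure (\<rho> \<theta>) M)"

definition fin_diff :: "(real^'m \<Rightarrow> complex^'d^'d) \<Rightarrow> real \<Rightarrow> 'm \<Rightarrow> real \<Rightarrow> real^'m \<Rightarrow> complex^'d^'d" where
  "fin_diff \<rho> t i \<delta> \<theta> =
     (1 / \<delta>) *\<^sub>R (\<rho> (\<theta> + (t * \<delta>) *\<^sub>R axis i 1) - \<rho> (\<theta> - ((1 - t) * \<delta>) *\<^sub>R axis i 1))"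

definition JS_mat :: "complex^'d^'d \<Rightarrow> ('m \<Rightarrow> complex^'d^'d) \<Rightarrow> complex^'m^'m" where
  "JS_mat \<rho> L = (\<chi> i j. (1/2) * trace (\<rho> ** (L i ** L j + L j ** L i)))"

definition JR_mat :: "complex^'d^'d \<Rightarrow> ('m \<Rightarrow> complex^'d^'d) \<Rightarrow> complex^'m^'m" where
  "JR_mat \<rho> L = (\<chi> i j. trace (\<rho> ** L j ** adjoint_mat (L i)))"

definition cmat_of_real :: "real^'n^'n \<Rightarrow> complex^'n^'n" where
  "cmat_of_real G = (\<chi> i j. complex_of_real (G $ i $ j))"

definition Im_mat :: "complex^'n^'n \<Rightarrow> real^'n^'n" where
  "Im_mat A = (\<chi> i j. Im (A $ i $ j))"

definition real_pd_mat :: "real^'n^'n \<Rightarrow> bool" where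
  "real_pd_mat G \<longleftrightarrow> transpose G = G \<and> (\<forall>x. x \<noteq> 0 \<longrightarrow> 0 < x \<bullet> (G *v x))"

definition char_poly_mat :: "complex^'n^'n \<Rightarrow> complex poly" where
  "char_poly_mat A = det (\<chi> i j. (if i = j then [:0, 1:] else 0) - [: A $ i $ j :])"

definition Spabs :: "real^'n^'n \<Rightarrow> real" where
  "Spabs A = (let p = char_poly_mat (cmat_of_real A) in
               \<Sum>z\<in>{z. poly p z = 0}. real (order z p) * cmod z)"

end

theory Submission
  imports Defs
begin

text \<open>For complex weights \<open>w, d\<close> put \<open>f(x) = \<Sum>\<^sub>j cnj (w\<^sub>j) (x\<^sub>j - \<theta>\<^sub>j)\<close> and \<open>L = \<Sum>\<^sub>k d\<^sub>k L\<^sub>k\<close>. Integrating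
  the nonnegative measure \<open>Tr \<rho> (L - cnj f(x)) M(dx) (L - cnj f(x))\<^sup>\<dagger>\<close> and expanding gives
  \<open>2 Re (w\<^sup>\<dagger> d) \<le> d\<^sup>\<dagger> J d + w\<^sup>\<dagger> V w\<close>, because unbiasedness at the two shifted points turns the
  finite difference of the mean of \<open>f\<close> into a component of \<open>w\<close>. With \<open>d = J\<^sup>-\<^sup>1 w\<close> this is
  \<open>V \<ge> J\<^sup>-\<^sup>1\<close>, for real \<open>w\<close> in the symmetric case and for complex \<open>w\<close> in the right case. In the
  latter, \<open>V - Re J\<^sup>-\<^sup>1\<close> dominates both \<open>i Im J\<^sup>-\<^sup>1\<close> and, by complex conjugation, \<open>- i Im J\<^sup>-\<^sup>1\<close>.
  Diagonalising \<open>i Im J\<^sup>-\<^sup>1\<close> relative to \<open>G\<close> and adding up the diagonal entries yields the term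
  \<open>Spabs\<close>.\<close>

section \<open>Hermitian matrices\<close>

definition cinner :: "complex^'n \<Rightarrow> complex^'n \<Rightarrow> complex" where
  "cinner u v = (\<Sum>i\<in>UNIV. cnj (u $ i) * v $ i)"

lemma cinner_add_left: "cinner (x + y) z = cinner x z + cinner y z"
  by (simp add: cinner_def algebra_simps sum.distrib)

lemma cinner_add_right: "cinner x (y + z) = cinner x y + cinner x z"
  by (simp add: cinner_def algebra_simps sum.distrib)

lemma cinner_diff_right: "cinner x (y - z) = cinner x y - cinner x z"
  by (simp add: cinner_def algebra_simps sum_subtractf)

lemma cinner_mult_right: "cinner x (c *s y) = c * cinner x y"
  by (simp add: cinner_def sum_distrib_left algebra_simps)

lemma cinner_scaleR_left: "cinner (r *\<^sub>R x) y = of_real r * cinner x y"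
  by (simp add: cinner_def sum_distrib_left scaleR_conv_of_real[where 'a=complex] mult_ac)

lemma cinner_scaleR_right: "cinner x (r *\<^sub>R y) = of_real r * cinner x y"
  by (simp add: cinner_def sum_distrib_left scaleR_conv_of_real[where 'a=complex] mult_ac)

lemma cnj_cinner: "cnj (cinner x y) = cinner y x"
  by (simp add: cinner_def algebra_simps)

lemma cinner_self: "cinner x x = of_real ((norm x)\<^sup>2)"
  by (simp add: cinner_def norm_vec_def L2_set_def sum_nonneg complex_norm_square[symmetric]
      mult.commute del: of_real_power)

lemma continuous_on_cinner [continuous_intros]:
  "continuous_on S f \<Longrightarrow> continuous_on S g \<Longrightarrow> continuous_on S (\<lambda>x. cinner (f x) (g x))"
  unfolding cinner_def by (intro continuous_intros)

lemma adjoint_mat_nth [simp]: "adjoint_mat A $ i $ j = cnj (A $ j $ i)"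
  by (simp add: adjoint_mat_def)

lemma adjoint_mat_adjoint_mat [simp]: "adjoint_mat (adjoint_mat A) = A"
  by (simp add: vec_eq_iff)

lemma adjoint_mat_mult: "adjoint_mat (A ** B) = adjoint_mat B ** adjoint_mat A"
  by (simp add: vec_eq_iff matrix_matrix_mult_def mult.commute)

lemma adjoint_mat_diff: "adjoint_mat (A - B) = adjoint_mat A - adjoint_mat B"
  by (simp add: vec_eq_iff)

lemma adjoint_mat_mat [simp]: "adjoint_mat (mat a) = mat (cnj a)"
  by (simp add: vec_eq_iff mat_def)

lemma trace_adjoint_mat: "trace (adjoint_mat A) = cnj (trace A)"
  by (simp add: trace_def)

lemma mat_mult_nth: "(mat a ** B) $ i $ j = a * (B :: complex^'n^'n) $ i $ j"
proof -
  have "(mat a ** B) $ i $ j = (\<Sum>k\<in>UNIV. if k = i then a * B $ i $ j else 0)"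
    unfolding matrix_matrix_mult_def vec_lambda_beta by (intro sum.cong) (auto simp: mat_def)
  then show ?thesis by simp
qed

lemma trace_mat_mult: "trace (mat a ** A) = (a::complex) * trace A"
  by (simp add: trace_def mat_mult_nth sum_distrib_left)

lemma matrix_mul_mat: "(A::complex^'n^'n) ** mat a = mat a ** A"
  by (simp add: vec_eq_iff matrix_matrix_mult_def mat_def if_distrib if_distribR mult.commute cong: if_cong)

lemma matrix_diff_ldistrib: "(A::'a::ring_1^'n^'m) ** (B - C) = A ** B - A ** C"
  by (simp add: vec_eq_iff matrix_matrix_mult_def algebra_simps sum_subtractf)

lemma matrix_diff_rdistrib: "((B::'a::ring_1^'n^'m) - C) ** A = B ** A - C ** A"
  by (simp add: vec_eq_iff matrix_matrix_mult_def algebra_simps sum_subtractf)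

lemma matrix_add_rdistrib: "((B::'a::semiring_1^'n^'m) + C) ** A = B ** A + C ** A"
  by (simp add: vec_eq_iff matrix_matrix_mult_def algebra_simps sum.distrib)

lemma cinner_matrix_left: "cinner (A *v x) y = cinner x (adjoint_mat A *v y)"
  unfolding cinner_def matrix_vector_mult_def
  by (simp add: sum_distrib_left sum_distrib_right mult_ac) (rule sum.swap)

lemma qform_eq_cinner: "qform A v = cinner v (A *v v)"
  by (simp add: qform_def cinner_def matrix_vector_mult_def sum_distrib_left mult_ac)

lemma qform_mult: "qform (adjoint_mat C ** B ** C) v = qform B (C *v v)"
  by (simp add: qform_eq_cinner cinner_matrix_left matrix_vector_mul_assoc matrix_mul_assoc)

lemma psd_mat_conjugate: "psd_mat B \<Longrightarrow> psd_mat (adjoint_mat C ** B ** C)"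
  by (simp add: psd_mat_def qform_mult hermitian_mat_def adjoint_mat_mult matrix_mul_assoc)

section \<open>Spectral theorem for Hermitian matrices and its consequences for positive
  ones\<close>

text \<open>The next eigenvector maximises the Rayleigh quotient on the orthogonal complement
  of those already found.\<close>

lemma hermitian_eigenvector_orthogonal:
  fixes A :: "complex^'n^'n" and u :: "'n \<Rightarrow> complex^'n"
  assumes herm: "hermitian_mat A" and "k \<notin> S"
    and eig: "\<And>i. i \<in> S \<Longrightarrow> A *v u i = of_real (l i) *s u i"
  obtains x r where "cinner x x = 1" "A *v x = of_real r *s x" "\<And>i. i \<in> S \<Longrightarrow> cinner (u i) x = 0"
proof -
  define W where "W = {x. \<forall>i\<in>S. cinner (u i) x = 0}"
  have adj: "adjoint_mat A = A" using herm by (simp add: hermitian_mat_def)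
  have A_sym: "cinner x (A *v y) = cinner (A *v x) y" for x y
    by (simp add: cinner_matrix_left adj)
  have W_A: "A *v x \<in> W" if "x \<in> W" for x
    using that eig unfolding W_def
    by (auto simp: A_sym cinner_mult_right) (metis cinner_mult_right cnj_cinner complex_cnj_zero mult_zero_right)
  have W_add: "x + y \<in> W" if "x \<in> W" "y \<in> W" for x y
    using that by (auto simp: W_def cinner_add_right)
  have W_scaleR: "r *\<^sub>R x \<in> W" if "x \<in> W" for x r
    using that by (auto simp: W_def cinner_scaleR_right)
  have W_nonzero: "\<exists>x\<in>W. x \<noteq> 0"
  proof -
    \<comment> \<open>The rows of \<open>B\<close> indexed by \<open>S\<close> are the conjugated
      eigenvectors found so far, so its kernel lies in \<open>W\<close>. Row \<open>k\<close> is
      zero, which makes \<open>B\<close> singular and the kernel nontrivial.\<close>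
    define B :: "complex^'n^'n" where "B = (\<chi> i j. if i \<in> S then cnj (u i $ j) else 0)"
    have "row k B = 0" using \<open>k \<notin> S\<close> by (simp add: row_def B_def vec_eq_iff)
    then have "det B = 0" by (simp add: det_zero_row)
    then have "\<not> (\<exists>C. C ** B = mat 1)"
      by (metis invertible_det_nz invertible_left_inverse)
    then obtain x where x: "B *v x = 0" "x \<noteq> 0"
      using matrix_left_invertible_ker by blast
    have "cinner (u i) x = 0" if "i \<in> S" for i
    proof -
      have "cinner (u i) x = (B *v x) $ i"
        using that by (simp add: cinner_def B_def matrix_vector_mult_def)
      then show ?thesis using x by simp
    qed
    with x show ?thesis by (auto simp: W_def)
  qed
  define K where "K = W \<inter> sphere 0 1"
  have "closed W"
    unfolding W_def Ball_def
    by (intro closed_Collect_all closed_Collect_imp open_Collect_const closed_Collect_eq continuous_intros)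
  then have "compact K" unfolding K_def by (simp add: closed_Int_compact)
  moreover have "K \<noteq> {}"
  proof -
    obtain x where "x \<in> W" "x \<noteq> 0" using W_nonzero by blast
    then have "(1 / norm x) *\<^sub>R x \<in> K" by (simp add: K_def W_scaleR)
    then show ?thesis by blast
  qed
  moreover have "continuous_on K (\<lambda>x. Re (qform A x))"
    unfolding qform_eq_cinner matrix_vector_mult_def by (intro continuous_intros)
  ultimately obtain x where x: "x \<in> K" and max: "\<forall>y\<in>K. Re (qform A y) \<le> Re (qform A x)"
    using continuous_attains_sup[of K "\<lambda>x. Re (qform A x)"] by blast
  define r where "r = Re (qform A x)"
  \<comment> \<open>Maximality of \<open>r\<close> makes \<open>Q\<close> nonnegative on
    \<open>W\<close>, and \<open>Q x = 0\<close>. A nonzero residual \<open>z\<close> below would be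
    a direction inside \<open>W\<close> along which \<open>Q\<close> becomes negative.\<close>
  define Q where "Q y = r * (norm y)\<^sup>2 - Re (qform A y)" for y
  have xW: "x \<in> W" and nx: "norm x = 1" using x by (auto simp: K_def)
  have xx: "cinner x x = 1" by (simp add: cinner_self nx)
  have qform_scaleR: "qform A (c *\<^sub>R y) = of_real (c\<^sup>2) * qform A y" for c y
    by (simp add: qform_def sum_distrib_left power2_eq_square scaleR_conv_of_real[where 'a=complex] mult_ac)
  have Q_nonneg: "0 \<le> Q y" if "y \<in> W" for y
  proof (cases "y = 0")
    case False
    have "(1 / norm y) *\<^sub>R y \<in> K" using that False by (simp add: K_def W_scaleR)
    then have "(1 / norm y)\<^sup>2 * Re (qform A y) \<le> r"
      using max unfolding r_def by (auto simp: qform_scaleR dest!: bspec)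
    then show ?thesis using False by (simp add: Q_def field_simps)
  qed (simp add: Q_def qform_eq_cinner cinner_def)
  define z where "z = A *v x - of_real r *s x"
  have zW: "z \<in> W"
    using W_A[OF xW] xW by (auto simp: z_def W_def cinner_diff_right cinner_mult_right)
  have Q_line: "Q (x + s *\<^sub>R z) = s\<^sup>2 * Q z - 2 * s * (norm z)\<^sup>2" for s
  proof -
    have n: "(norm y)\<^sup>2 = Re (cinner y y)" for y :: "complex^'n"
      by (simp add: cinner_self)
    have sz: "A *v (s *\<^sub>R z) = s *\<^sub>R (A *v z)"
      by (simp add: vec_eq_iff matrix_vector_mult_def scaleR_sum_right)
    have zx: "Re (cinner x (A *v z)) = Re (cinner z (A *v x))"
      by (metis A_sym cnj_cinner cnj.simps(1))
    have xz: "Re (cinner x z) = Re (cinner z x)"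
      by (metis cnj_cinner cnj.simps(1))
    have "Re (cinner z (A *v x)) = Re (cinner z z) + r * Re (cinner z x)"
    proof -
      have "cinner z (A *v x) = cinner z z + of_real r * cinner z x"
        unfolding z_def by (simp add: cinner_diff_right cinner_mult_right)
      then show ?thesis by simp
    qed
    moreover have "Re (cinner x (A *v x)) = r" by (simp add: r_def qform_eq_cinner)
    ultimately show ?thesis
      unfolding Q_def n qform_eq_cinner
      by (simp add: matrix_vector_right_distrib sz cinner_add_left cinner_add_right
          cinner_scaleR_left cinner_scaleR_right zx xz xx algebra_simps power2_eq_square)
  qed
  have "z = 0"
  proof (rule ccontr)
    assume "z \<noteq> 0"
    then have p: "0 < (norm z)\<^sup>2" by simp
    have Qz: "0 \<le> Q z" using Q_nonneg[OF zW] .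
    \<comment> \<open>Any \<open>s > 0\<close> with \<open>s * Q z < 2 * (norm z)\<^sup>2\<close>
      contradicts \<open>Q_line\<close>; the added 1 keeps the denominator positive when
      \<open>Q z = 0\<close>.\<close>
    define s where "s = (norm z)\<^sup>2 / (Q z + 1)"
    have s: "0 < s" using p Qz by (simp add: s_def)
    have "s * Q z < 2 * (norm z)\<^sup>2"
    proof -
      have "s * Q z \<le> s * (Q z + 1)" using s by simp
      also have "\<dots> = (norm z)\<^sup>2" using Qz by (simp add: s_def)
      finally show ?thesis using p by linarith
    qed
    then have "s * (s * Q z) < s * (2 * (norm z)\<^sup>2)" using s by (rule mult_strict_left_mono)
    then have "Q (x + s *\<^sub>R z) < 0" unfolding Q_line by (simp add: power2_eq_square mult_ac)
    with Q_nonneg[OF W_add[OF xW W_scaleR[OF zW, of s]]] show False by simp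
  qed
  then have "A *v x = of_real r *s x" by (simp add: z_def)
  with that xx xW show thesis by (auto simp: W_def)
qed

text \<open>Induction over finite index sets: as long as an index is missing, there is room for one
  more eigenvector orthogonal to the earlier ones.\<close>

lemma hermitian_eigenbasis:
  fixes A :: "complex^'n^'n"
  assumes herm: "hermitian_mat A"
  obtains u :: "'n \<Rightarrow> complex^'n" and l :: "'n \<Rightarrow> real"
  where "\<forall>i j. cinner (u i) (u j) = (if i = j then 1 else 0)" "\<forall>i. A *v u i = of_real (l i) *s u i"
proof -
  have "\<exists>(u :: 'n \<Rightarrow> complex^'n) l. (\<forall>i\<in>S. \<forall>j\<in>S. cinner (u i) (u j) = (if i = j then 1 else 0))
      \<and> (\<forall>i\<in>S. A *v u i = of_real (l i) *s u i)" if "finite S" for S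
    using that
  proof (induction S rule: finite_induct)
    case (insert k S)
    then obtain u :: "'n \<Rightarrow> complex^'n" and l where
      on: "\<forall>i\<in>S. \<forall>j\<in>S. cinner (u i) (u j) = (if i = j then 1 else 0)"
      and eig: "\<forall>i\<in>S. A *v u i = of_real (l i) *s u i" by blast
    obtain x r where x: "cinner x x = 1" "A *v x = of_real r *s x" "\<And>i. i \<in> S \<Longrightarrow> cinner (u i) x = 0"
      by (rule hermitian_eigenvector_orthogonal[OF herm insert.hyps(2), of u l]) (use eig in auto)
    have x': "cinner x (u i) = 0" if "i \<in> S" for i
      using x(3)[OF that] by (metis cnj_cinner complex_cnj_zero)
    show ?case
      by (rule exI[of _ "u(k := x)"], rule exI[of _ "l(k := r)"])
        (use insert.hyps on eig x x' in auto)
  qed simp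
  from this[of UNIV] that show thesis by (auto simp: finite)
qed

definition real_diag :: "('n \<Rightarrow> real) \<Rightarrow> complex^'n^'n" where
  "real_diag l = (\<chi> i j. if i = j then of_real (l i) else 0)"

lemma matrix_mul_real_diag: "(A ** real_diag l) $ i $ j = A $ i $ j * of_real (l j)"
proof -
  have "(A ** real_diag l) $ i $ j = (\<Sum>k\<in>UNIV. if k = j then A $ i $ j * of_real (l j) else 0)"
    unfolding matrix_matrix_mult_def real_diag_def vec_lambda_beta by (intro sum.cong) auto
  then show ?thesis by simp
qed

lemma real_diag_mult: "real_diag l ** real_diag k = real_diag (\<lambda>i. l i * k i)"
  by (simp add: vec_eq_iff matrix_mul_real_diag) (simp add: real_diag_def)

lemma adjoint_real_diag: "adjoint_mat (real_diag l) = real_diag l"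
  by (simp add: vec_eq_iff real_diag_def)

lemma qform_axis: "qform A (axis i 1) = A $ i $ i"
proof -
  have "qform A (axis i 1) = (\<Sum>k\<in>UNIV. if k = i then (A *v axis i 1) $ i else 0)"
    unfolding qform_eq_cinner cinner_def by (intro sum.cong) (auto simp: axis_def)
  also have "\<dots> = (\<Sum>k\<in>UNIV. A $ i $ k * axis i 1 $ k)"
    by (simp add: matrix_vector_mult_def)
  also have "\<dots> = (\<Sum>k\<in>UNIV. if k = i then A $ i $ i else 0)"
    by (intro sum.cong) (auto simp: axis_def)
  finally show ?thesis by simp
qed

text \<open>The eigenbasis supplies the columns of \<open>U\<close>: orthonormality makes
  \<open>U\<close> unitary, and the eigenvalue equations read
  \<open>A ** U = U ** real_diag l\<close>.\<close>

lemma hermitian_spectral: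
  fixes A :: "complex^'n^'n"
  assumes "hermitian_mat A"
  obtains U l where "adjoint_mat U ** U = mat 1" "U ** adjoint_mat U = mat 1"
    "adjoint_mat U ** A ** U = real_diag l"
proof -
  obtain u :: "'n \<Rightarrow> complex^'n" and l
    where on: "\<forall>i j. cinner (u i) (u j) = (if i = j then 1 else 0)"
    and eig: "\<forall>i. A *v u i = of_real (l i) *s u i"
    using hermitian_eigenbasis[OF assms] by blast
  define U where "U = (\<chi> i j. u j $ i)"
  have 1: "adjoint_mat U ** U = mat 1"
    using on by (simp add: vec_eq_iff U_def matrix_matrix_mult_def cinner_def mat_def)
  then have 2: "U ** adjoint_mat U = mat 1" by (rule matrix_left_right_inverse1)
  have "A ** U = U ** real_diag l"
    using eig by (simp add: vec_eq_iff matrix_mul_real_diag mult.commute)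
      (simp add: U_def matrix_matrix_mult_def matrix_vector_mult_def)
  then have "adjoint_mat U ** A ** U = real_diag l"
    by (metis 1 matrix_mul_assoc matrix_mul_lid)
  with 1 2 that show thesis by blast
qed

text \<open>Diagonalisation preserves positivity, so testing on axis vectors shows that the
  eigenvalues are nonnegative. Then \<open>C\<close> is \<open>U\<close> times the diagonal matrix
  of their square roots.\<close>

lemma psd_mat_factor:
  assumes "psd_mat A"
  obtains C where "A = C ** adjoint_mat C"
proof -
  obtain U l where U: "adjoint_mat U ** U = mat 1" "U ** adjoint_mat U = mat 1"
    and D: "adjoint_mat U ** A ** U = real_diag l"
    using hermitian_spectral[of A] assms unfolding psd_mat_def by blast
  have nonneg: "0 \<le> l i" for i
  proof -
    have "psd_mat (real_diag l)" using psd_mat_conjugate[OF assms, of U] D by simp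
    then have "0 \<le> Re (qform (real_diag l) (axis i 1))" by (simp add: psd_mat_def)
    also have "qform (real_diag l) (axis i 1) = of_real (l i)"
      by (simp add: qform_axis real_diag_def)
    finally show ?thesis by simp
  qed
  define R :: "complex^'a^'a" where "R = real_diag (\<lambda>i. sqrt (l i))"
  have R: "R ** adjoint_mat R = real_diag l"
    using nonneg by (simp add: R_def adjoint_real_diag real_diag_mult)
  have "A = U ** (adjoint_mat U ** A ** U) ** adjoint_mat U"
    by (metis U(2) matrix_mul_assoc matrix_mul_lid matrix_mul_rid)
  also have "\<dots> = (U ** R) ** adjoint_mat (U ** R)"
    unfolding D R[symmetric] by (simp add: adjoint_mat_mult matrix_mul_assoc)
  finally show thesis by (rule that)
qed

lemma qform_column: "qform B (column k C) = (adjoint_mat C ** B ** C) $ k $ k"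
  by (simp add: matrix_matrix_mult_def qform_def column_def sum_distrib_right) (rule sum.swap)

lemma trace_conjugate: "trace (adjoint_mat C ** B ** C) = (\<Sum>k\<in>UNIV. qform B (column k C))"
  by (simp add: qform_column trace_def)

text \<open>Factoring \<open>A = C ** adjoint_mat C\<close> and cycling the trace leaves a sum of
  values of the quadratic form of \<open>B\<close> at the columns of \<open>C\<close>.\<close>

lemma trace_psd_mult_nonneg:
  assumes "psd_mat A" "psd_mat B"
  shows "0 \<le> Re (trace (A ** B))"
proof -
  obtain C where C: "A = C ** adjoint_mat C" using psd_mat_factor assms by blast
  have "trace (A ** B) = trace (adjoint_mat C ** B ** C)"
    unfolding C by (metis matrix_mul_assoc trace_mul_sym)
  also have "Re \<dots> \<ge> 0"
    using assms by (simp add: trace_conjugate psd_mat_def sum_nonneg)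
  finally show ?thesis .
qed

section \<open>The outcome measures of a POVM\<close>

text \<open>Conjugation reverses the product, which the trace does not notice. Outcome measures
  record only \<open>Re\<close> of such traces; this shows that nothing is lost.\<close>

lemma trace_hermitian_mult_real:
  assumes "hermitian_mat A" "hermitian_mat B"
  shows "trace (A ** B) = of_real (Re (trace (A ** B)))"
proof -
  have "cnj (trace (A ** B)) = trace (B ** A)"
    unfolding trace_adjoint_mat[symmetric]
    using assms by (simp add: adjoint_mat_mult hermitian_mat_def)
  then have "cnj (trace (A ** B)) = trace (A ** B)"
    by (simp only: trace_mul_sym[of B A])
  then show ?thesis by (metis Reals_cnj_iff of_real_Re)
qed

lemma povm_psd: "povm M \<Longrightarrow> E \<in> sets borel \<Longrightarrow> psd_mat (M E)"
  by (simp add: povm_def)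

lemma povm_UNIV: "povm M \<Longrightarrow> M UNIV = mat 1"
  by (simp add: povm_def)

lemma povm_trace_sums:
  fixes E :: "nat \<Rightarrow> (real^'m) set"
  assumes "povm M" "range E \<subseteq> sets borel" "disjoint_family E"
  shows "(\<lambda>n. trace (A ** M (E n))) sums trace (A ** M (\<Union>n. E n))"
proof -
  have "(\<lambda>n. M (E n) $ i $ j) sums (M (\<Union>n. E n) $ i $ j)" for i j
    using assms by (simp add: povm_def)
  then show ?thesis
    unfolding trace_def matrix_matrix_mult_def vec_lambda_beta
    by (intro sums_sum sums_mult)
qed

text \<open>Countable additivity for the constantly empty family gives a convergent series with
  constant terms, which forces the terms to vanish.\<close>

lemma povm_empty:
  assumes "povm M" shows "M {} = 0"
proof -
  have "(\<lambda>n::nat. M {} $ i $ j) sums (M {} $ i $ j)" for i j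
    using assms[unfolded povm_def, THEN conjunct2, THEN conjunct2, rule_format, of "\<lambda>_. {}" i j]
    by (auto simp: disjoint_family_on_def)
  then have "(\<lambda>n::nat. M {} $ i $ j) \<longlonglongrightarrow> 0" for i j
    using sums_summable summable_LIMSEQ_zero by blast
  then show ?thesis by (simp add: vec_eq_iff LIMSEQ_const_iff)
qed

lemma sets_outcome_measure [simp, measurable_cong]: "sets (outcome_measure A M) = sets borel"
  unfolding outcome_measure_def by (metis sets.sets_measure_of_eq space_borel)

lemma space_outcome_measure [simp]: "space (outcome_measure A M) = UNIV"
  by (simp add: outcome_measure_def space_measure_of_conv)

text \<open>\<open>measure_of\<close> keeps the prescribed values only if they form a measure, so
  additivity has to be verified. Nonnegativity of the traces matters there, because
  \<open>ennreal\<close> truncates negative numbers to 0.\<close>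

lemma emeasure_outcome_measure:
  fixes M :: "(real^'m) set \<Rightarrow> complex^'d^'d"
  assumes A: "psd_mat A" and M: "povm M" and E: "E \<in> sets borel"
  shows "emeasure (outcome_measure A M) E = ennreal (Re (trace (A ** M E)))"
proof -
  let ?f = "\<lambda>E. ennreal (Re (trace (A ** M E)))"
  have nonneg: "0 \<le> Re (trace (A ** M E))" if "E \<in> sets borel" for E
    using A povm_psd[OF M that] by (rule trace_psd_mult_nonneg)
  have "sigma_algebra UNIV (sets (borel :: (real^'m) measure))"
    using sets.sigma_algebra_axioms[of "borel :: (real^'m) measure"] by simp
  moreover have "positive (sets borel) ?f"
    by (simp add: positive_def povm_empty[OF M] trace_def matrix_matrix_mult_def)
  moreover have "countably_additive (sets borel) ?f"
  proof (rule countably_additiveI)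
    fix F :: "nat \<Rightarrow> (real^'m) set"
    assume F: "range F \<subseteq> sets borel" "disjoint_family F" "(\<Union>i. F i) \<in> sets borel"
    have "(\<lambda>n. Re (trace (A ** M (F n)))) sums Re (trace (A ** M (\<Union>n. F n)))"
      by (rule sums_Re[OF povm_trace_sums[OF M F(1,2)]])
    then have "(\<lambda>n. ?f (F n)) sums ?f (\<Union>n. F n)"
      using F nonneg by (subst sums_ennreal) auto
    then show "(\<Sum>n. ?f (F n)) = ?f (\<Union>n. F n)" by (rule sums_unique[symmetric])
  qed
  ultimately show ?thesis
    unfolding outcome_measure_def using E by (rule emeasure_measure_of_sigma)
qed

lemma measure_outcome_measure:
  assumes "psd_mat A" "povm M" "E \<in> sets borel"
  shows "measure (outcome_measure A M) E = Re (trace (A ** M E))"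
  using emeasure_outcome_measure[OF assms] trace_psd_mult_nonneg[OF assms(1) povm_psd[OF assms(2,3)]]
  by (simp add: measure_def)

text \<open>Trace one is not assumed, since the unnormalised operator
  \<open>adjoint_mat L ** \<rho> ** L\<close> also serves as \<open>A\<close> below.\<close>

lemma finite_measure_outcome_measure:
  assumes "psd_mat A" "povm M"
  shows "finite_measure (outcome_measure A M)"
  by (rule finite_measureI) (simp add: emeasure_outcome_measure[OF assms])

section \<open>Integrals of outcome functions and the basic quadratic inequality\<close>

lemma (in finite_measure) integral_compose_simple_function:
  fixes h :: "'b \<Rightarrow> 'c::{banach, second_countable_topology}"
  assumes "simple_function M s"
  shows "(\<integral>x. h (s x) \<partial>M) = (\<Sum>v\<in>s ` space M. measure M (s -` {v} \<inter> space M) *\<^sub>R h v)"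
proof -
  have fin: "finite (s ` space M)" and meas: "s -` {v} \<inter> space M \<in> sets M" for v
    using assms by (simp_all add: simple_functionD)
  have "(\<integral>x. h (s x) \<partial>M) = (\<integral>x. (\<Sum>v\<in>s ` space M. indicator (s -` {v} \<inter> space M) x *\<^sub>R h v) \<partial>M)"
  proof (rule Bochner_Integration.integral_cong[OF refl])
    fix x assume x: "x \<in> space M"
    have "(\<Sum>v\<in>s ` space M. indicator (s -` {v} \<inter> space M) x *\<^sub>R h v)
        = (\<Sum>v\<in>s ` space M. if v = s x then h v else 0)"
      using x by (intro sum.cong) (auto simp: indicator_def)
    then show "h (s x) = (\<Sum>v\<in>s ` space M. indicator (s -` {v} \<inter> space M) x *\<^sub>R h v)"
      using x fin by simp
  qed
  also have "\<dots> = (\<Sum>v\<in>s ` space M. \<integral>x. indicator (s -` {v} \<inter> space M) x *\<^sub>R h v \<partial>M)"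
    using meas by (intro Bochner_Integration.integral_sum) (auto simp: emeasure_eq_measure)
  also have "\<dots> = (\<Sum>v\<in>s ` space M. measure M (s -` {v} \<inter> space M) *\<^sub>R h v)"
    using meas by (intro sum.cong) (auto simp: emeasure_eq_measure)
  finally show ?thesis .
qed

text \<open>With \<open>N = L - mat (cnj a)\<close>, this expands the nonnegative number
  \<open>trace (adjoint_mat N ** \<rho> ** N ** X)\<close>. The two cross terms are complex
  conjugates of each other, hence the factor 2 and the real part.\<close>

lemma trace_square_expand:
  fixes \<rho> L X :: "complex^'d^'d"
  assumes \<rho>: "psd_mat \<rho>" and X: "psd_mat X"
  shows "2 * Re (a * trace (\<rho> ** L ** X))
    \<le> Re (trace (adjoint_mat L ** \<rho> ** L ** X)) + (cmod a)\<^sup>2 * Re (trace (\<rho> ** X))"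
proof -
  have herm: "adjoint_mat \<rho> = \<rho>" "adjoint_mat X = X"
    using \<rho> X by (simp_all add: psd_mat_def hermitian_mat_def)
  have "trace (adjoint_mat L ** \<rho> ** X) = cnj (trace (\<rho> ** L ** X))"
    by (metis adjoint_mat_mult herm matrix_mul_assoc trace_adjoint_mat trace_mul_sym)
  then have cross: "Re (cnj a * trace (adjoint_mat L ** \<rho> ** X)) = Re (a * trace (\<rho> ** L ** X))"
    by simp
  let ?N = "L - mat (cnj a)"
  have "trace (adjoint_mat ?N ** \<rho> ** ?N ** X)
      = trace (adjoint_mat L ** \<rho> ** L ** X) - a * trace (\<rho> ** L ** X)
        - cnj a * trace (adjoint_mat L ** \<rho> ** X) + a * cnj a * trace (\<rho> ** X)"
    by (simp add: adjoint_mat_diff matrix_diff_ldistrib matrix_diff_rdistrib trace_sub trace_mat_mult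
        matrix_mul_mat matrix_mul_assoc[symmetric])
  moreover have "0 \<le> Re (trace (adjoint_mat ?N ** \<rho> ** ?N ** X))"
    by (intro trace_psd_mult_nonneg psd_mat_conjugate assms)
  moreover have "a * cnj a = of_real ((cmod a)\<^sup>2)" by (rule complex_norm_square[symmetric])
  ultimately show ?thesis using cross by simp
qed

text \<open>A finite-valued \<open>s\<close> splits the POVM into finitely many effects, and
  \<open>trace_square_expand\<close> is summed over them. The assumption \<open>pairing\<close>
  compares only real parts, so that it covers right operators with complex weights as well as
  symmetric operators with real weights.\<close>

lemma simple_estimator_bound:
  fixes s :: "real^'m \<Rightarrow> real^'m" and M :: "(real^'m) set \<Rightarrow> complex^'d^'d"
  assumes M: "povm M" and \<rho>: "psd_mat \<rho>" and s: "simple_function borel s"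
    and A: "\<And>k. k \<in> I \<Longrightarrow> psd_mat (A k)" and B: "\<And>k. k \<in> I \<Longrightarrow> psd_mat (B k)"
    and pairing: "\<And>v X. psd_mat X \<Longrightarrow>
      Re (h v * trace (\<rho> ** L ** X)) = Re (h v * (\<Sum>k\<in>I. e k * (trace (A k ** X) - trace (B k ** X))))"
  shows "2 * Re (\<Sum>k\<in>I. e k * ((\<integral>x. h (s x) \<partial>outcome_measure (A k) M) - (\<integral>x. h (s x) \<partial>outcome_measure (B k) M)))
    \<le> Re (trace (\<rho> ** L ** adjoint_mat L)) + (\<integral>x. (cmod (h (s x)))\<^sup>2 \<partial>outcome_measure \<rho> M)"
proof -
  define S where "S = range s"
  define X where "X v = M (s -` {v})" for v
  have level: "s -` {v} \<in> sets borel" for v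
    using simple_functionD(2)[OF s, of "{v}"] by simp
  have X: "psd_mat (X v)" for v unfolding X_def by (rule povm_psd[OF M level])
  have integral: "(\<integral>x. g (s x) \<partial>outcome_measure C M) = (\<Sum>v\<in>S. Re (trace (C ** X v)) *\<^sub>R g v)"
    if C: "psd_mat C" for C and g :: "real^'m \<Rightarrow> 'z::{banach, second_countable_topology}"
  proof -
    have "simple_function (outcome_measure C M) s"
      using s by (simp add: simple_function_def)
    from finite_measure.integral_compose_simple_function[OF finite_measure_outcome_measure[OF C M] this, of g]
    show ?thesis by (simp add: S_def X_def measure_outcome_measure[OF C M level])
  qed
  have real: "of_real (Re (trace (C ** X v))) = trace (C ** X v)" if "psd_mat C" for C v
    using trace_hermitian_mult_real that X[of v] by (metis psd_mat_def)
  \<comment> \<open>All integrals run over the same level sets, so the sum can be regrouped by value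
    of \<open>s\<close>, where \<open>pairing\<close> applies.\<close>
  have "(\<Sum>k\<in>I. e k * ((\<integral>x. h (s x) \<partial>outcome_measure (A k) M) - (\<integral>x. h (s x) \<partial>outcome_measure (B k) M)))
      = (\<Sum>k\<in>I. e k * ((\<Sum>v\<in>S. trace (A k ** X v) * h v) - (\<Sum>v\<in>S. trace (B k ** X v) * h v)))"
    using A B by (intro sum.cong) (auto simp: integral real scaleR_conv_of_real)
  also have "\<dots> = (\<Sum>v\<in>S. h v * (\<Sum>k\<in>I. e k * (trace (A k ** X v) - trace (B k ** X v))))"
    unfolding sum_subtractf[symmetric] sum_distrib_left
    by (subst sum.swap) (simp add: algebra_simps)
  finally have "2 * Re (\<Sum>k\<in>I. e k * ((\<integral>x. h (s x) \<partial>outcome_measure (A k) M) - (\<integral>x. h (s x) \<partial>outcome_measure (B k) M)))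
      = (\<Sum>v\<in>S. 2 * Re (h v * trace (\<rho> ** L ** X v)))"
    by (simp only: Re_sum pairing[OF X] sum_distrib_left)
  also have "\<dots> \<le> (\<Sum>v\<in>S. Re (trace (adjoint_mat L ** \<rho> ** L ** X v)) + (cmod (h v))\<^sup>2 * Re (trace (\<rho> ** X v)))"
    by (intro sum_mono trace_square_expand \<rho> X)
  also have "\<dots> = (\<Sum>v\<in>S. Re (trace (adjoint_mat L ** \<rho> ** L ** X v))) + (\<integral>x. (cmod (h (s x)))\<^sup>2 \<partial>outcome_measure \<rho> M)"
    by (simp add: sum.distrib integral[OF \<rho>, of "\<lambda>v. (cmod (h v))\<^sup>2"] mult.commute)
  also have "(\<Sum>v\<in>S. Re (trace (adjoint_mat L ** \<rho> ** L ** X v))) = Re (trace (\<rho> ** L ** adjoint_mat L))"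
  proof -
    \<comment> \<open>The terms quadratic in \<open>L\<close> are the masses of the level sets under
      one outcome measure; normalisation of the POVM gives their total.\<close>
    have psd: "psd_mat (adjoint_mat L ** \<rho> ** L)" by (rule psd_mat_conjugate[OF \<rho>])
    have "(\<Sum>v\<in>S. Re (trace (adjoint_mat L ** \<rho> ** L ** X v)))
        = (\<integral>x. 1 \<partial>outcome_measure (adjoint_mat L ** \<rho> ** L) M)"
      using integral[OF psd, of "\<lambda>_. 1::real"] by simp
    also have "\<dots> = Re (trace (adjoint_mat L ** \<rho> ** L))"
      using measure_outcome_measure[OF psd M, of UNIV] by (simp add: povm_UNIV[OF M])
    also have "trace (adjoint_mat L ** \<rho> ** L) = trace (\<rho> ** L ** adjoint_mat L)"
      by (metis matrix_mul_assoc trace_mul_sym)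
    finally show ?thesis .
  qed
  finally show ?thesis .
qed

text \<open>Simple functions approximate the centred outcome, and dominated convergence carries the
  bound to the limit. First moments dominate the integrals under \<open>A k\<close> and
  \<open>B k\<close>, and the second moment dominates the one under \<open>\<rho>\<close>.\<close>

lemma estimator_bound:
  fixes M :: "(real^'m) set \<Rightarrow> complex^'d^'d" and h :: "real^'m \<Rightarrow> complex"
  assumes M: "povm M" and \<rho>: "psd_mat \<rho>" and h: "bounded_linear h"
    and A: "\<And>k. k \<in> I \<Longrightarrow> psd_mat (A k)" and B: "\<And>k. k \<in> I \<Longrightarrow> psd_mat (B k)"
    and int_A: "\<And>k. k \<in> I \<Longrightarrow> integrable (outcome_measure (A k) M) (\<lambda>x. norm (x - \<theta>))"
    and int_B: "\<And>k. k \<in> I \<Longrightarrow> integrable (outcome_measure (B k) M) (\<lambda>x. norm (x - \<theta>))"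
    and int_\<rho>: "integrable (outcome_measure \<rho> M) (\<lambda>x. (norm (x - \<theta>))\<^sup>2)"
    and pairing: "\<And>v X. psd_mat X \<Longrightarrow>
      Re (h v * trace (\<rho> ** L ** X)) = Re (h v * (\<Sum>k\<in>I. e k * (trace (A k ** X) - trace (B k ** X))))"
  shows "2 * Re (\<Sum>k\<in>I. e k * ((\<integral>x. h (x - \<theta>) \<partial>outcome_measure (A k) M) - (\<integral>x. h (x - \<theta>) \<partial>outcome_measure (B k) M)))
    \<le> Re (trace (\<rho> ** L ** adjoint_mat L)) + (\<integral>x. (cmod (h (x - \<theta>)))\<^sup>2 \<partial>outcome_measure \<rho> M)"
proof -
  have "(\<lambda>x. x - \<theta>) \<in> borel_measurable borel" by measurable
  \<comment> \<open>Approximation around the centre 0 gives the factor 2 in \<open>bd\<close>, hence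
    the dominating functions with \<open>2 * C\<close> below.\<close>
  then obtain s where s: "\<And>n. simple_function borel (s n)"
    and lim: "\<And>x. (\<lambda>n. s n x) \<longlonglongrightarrow> x - \<theta>"
    and bd: "\<And>n x. norm (s n x) \<le> 2 * norm (x - \<theta>)"
    using borel_measurable_implies_sequence_metric[of "\<lambda>x. x - \<theta>" borel 0] by auto
  obtain C where C: "0 \<le> C" "\<And>v. cmod (h v) \<le> norm v * C"
    using bounded_linear.nonneg_bounded[OF h] by blast
  have h_meas [measurable]: "h \<in> borel_measurable borel"
    using h by (intro borel_measurable_continuous_onI linear_continuous_on)
  have s_meas [measurable]: "s n \<in> borel_measurable borel" for n
    using s by (rule borel_measurable_simple_function)
  have h_lim: "(\<lambda>n. h (s n x)) \<longlonglongrightarrow> h (x - \<theta>)" for x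
    by (rule bounded_linear.tendsto[OF h lim])
  have h_bd: "cmod (h (s n x)) \<le> 2 * C * norm (x - \<theta>)" for n x
    using order_trans[OF C(2) mult_right_mono[OF bd C(1)]] by (simp add: mult_ac)
  have meas_eq: "borel_measurable (outcome_measure E M) = borel_measurable borel" for E
    by (rule measurable_cong_sets) simp_all
  have lim1: "(\<lambda>n. \<integral>x. h (s n x) \<partial>outcome_measure E M) \<longlonglongrightarrow> (\<integral>x. h (x - \<theta>) \<partial>outcome_measure E M)"
    if "integrable (outcome_measure E M) (\<lambda>x. norm (x - \<theta>))" for E
    by (rule integral_dominated_convergence[where w = "\<lambda>x. 2 * C * norm (x - \<theta>)"])
      (use that h_lim h_bd in \<open>auto simp: meas_eq\<close>)
  have lim2: "(\<lambda>n. \<integral>x. (cmod (h (s n x)))\<^sup>2 \<partial>outcome_measure \<rho> M)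
      \<longlonglongrightarrow> (\<integral>x. (cmod (h (x - \<theta>)))\<^sup>2 \<partial>outcome_measure \<rho> M)"
  proof (rule integral_dominated_convergence[where w = "\<lambda>x. (2 * C)\<^sup>2 * (norm (x - \<theta>))\<^sup>2"])
    show "AE x in outcome_measure \<rho> M. norm ((cmod (h (s n x)))\<^sup>2) \<le> (2 * C)\<^sup>2 * (norm (x - \<theta>))\<^sup>2" for n
      using power_mono[OF h_bd, of _ _ 2] by (simp add: power_mult_distrib)
  qed (use int_\<rho> in \<open>auto simp: meas_eq intro!: tendsto_intros h_lim\<close>)
  show ?thesis
  proof (rule LIMSEQ_le)
    show "(\<lambda>n. 2 * Re (\<Sum>k\<in>I. e k * ((\<integral>x. h (s n x) \<partial>outcome_measure (A k) M) - (\<integral>x. h (s n x) \<partial>outcome_measure (B k) M))))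
      \<longlonglongrightarrow> 2 * Re (\<Sum>k\<in>I. e k * ((\<integral>x. h (x - \<theta>) \<partial>outcome_measure (A k) M) - (\<integral>x. h (x - \<theta>) \<partial>outcome_measure (B k) M)))"
      by (intro tendsto_intros lim1 int_A int_B)
    show "(\<lambda>n. Re (trace (\<rho> ** L ** adjoint_mat L)) + (\<integral>x. (cmod (h (s n x)))\<^sup>2 \<partial>outcome_measure \<rho> M))
      \<longlonglongrightarrow> Re (trace (\<rho> ** L ** adjoint_mat L)) + (\<integral>x. (cmod (h (x - \<theta>)))\<^sup>2 \<partial>outcome_measure \<rho> M)"
      by (intro tendsto_intros lim2)
    show "\<exists>N. \<forall>n\<ge>N. 2 * Re (\<Sum>k\<in>I. e k * ((\<integral>x. h (s n x) \<partial>outcome_measure (A k) M) - (\<integral>x. h (s n x) \<partial>outcome_measure (B k) M)))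
      \<le> Re (trace (\<rho> ** L ** adjoint_mat L)) + (\<integral>x. (cmod (h (s n x)))\<^sup>2 \<partial>outcome_measure \<rho> M)"
      by (intro exI allI impI simple_estimator_bound M \<rho> s A B pairing)
  qed
qed

section \<open>Absolute sums of eigenvalues\<close>

lemma qform_diff: "qform (A - B) v = qform A v - qform B v"
  by (simp add: qform_def algebra_simps sum_subtractf)

lemma qform_add: "qform (A + B) v = qform A v + qform B v"
  by (simp add: qform_def algebra_simps sum.distrib)

lemma pd_mat_imp_psd_mat:
  assumes "pd_mat A" shows "psd_mat A"
proof -
  have "0 \<le> Re (qform A v)" for v
    using assms by (cases "v = 0") (auto simp: pd_mat_def qform_def intro: less_imp_le)
  then show ?thesis using assms by (simp add: pd_mat_def psd_mat_def)
qed

text \<open>Evaluation commutes with the permutation expansion of the determinant. Identities of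
  characteristic polynomials thereby reduce to determinants of complex matrices at every
  point.\<close>

lemma poly_char_poly_mat: "poly (char_poly_mat A) z = det (mat z - A)"
proof -
  have "poly (char_poly_mat A) z = (\<Sum>p | p permutes UNIV. of_int (sign p) *
      (\<Prod>i\<in>UNIV. poly ((if i = p i then [:0, 1:] else 0) - [:A $ i $ p i:]) z))"
    by (simp add: char_poly_mat_def det_def poly_sum poly_prod)
  also have "\<dots> = det (mat z - A)"
    unfolding det_def by (intro sum.cong prod.cong arg_cong2[where f = "(*)"]) (auto simp: mat_def)
  finally show ?thesis .
qed

lemma char_poly_mat_similar:
  fixes A P Q :: "complex^'n^'n"
  assumes "Q ** P = mat 1"
  shows "char_poly_mat (Q ** A ** P) = char_poly_mat A"
proof -
  have "det Q * det P = 1"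
    using assms by (metis det_I det_mul)
  moreover have "mat z - Q ** A ** P = Q ** (mat z - A) ** P" for z
  proof -
    have "Q ** mat z ** P = mat z ** (Q ** P)"
      unfolding matrix_mul_mat by (rule matrix_mul_assoc[symmetric])
    then show ?thesis by (simp add: matrix_diff_ldistrib matrix_diff_rdistrib assms)
  qed
  ultimately have "poly (char_poly_mat (Q ** A ** P)) z = poly (char_poly_mat A) z" for z
    by (simp add: poly_char_poly_mat det_mul)
  then show ?thesis by (simp add: poly_eq_poly_eq_iff[symmetric] fun_eq_iff)
qed

text \<open>The scalar \<open>c\<close> lets a real antisymmetric matrix be treated later as a
  unimodular multiple of a Hermitian one.\<close>

lemma char_poly_mat_scaled_diag:
  "char_poly_mat (mat c ** real_diag l) = (\<Prod>k\<in>UNIV. [:- (c * of_real (l k)), 1:])"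
proof -
  have entry: "(mat c ** real_diag l) $ i $ j = (if i = j then c * of_real (l i) else 0)" for i j
    by (simp add: matrix_mul_real_diag) (simp add: mat_def)
  have "poly (char_poly_mat (mat c ** real_diag l)) z = poly (\<Prod>k\<in>UNIV. [:- (c * of_real (l k)), 1:]) z" for z
  proof -
    have "det (mat z - mat c ** real_diag l) = (\<Prod>k\<in>UNIV. (mat z - mat c ** real_diag l) $ k $ k)"
      by (rule det_diagonal) (simp add: entry, simp add: mat_def)
    then show ?thesis by (simp add: poly_char_poly_mat poly_prod entry) (simp add: mat_def)
  qed
  then show ?thesis by (simp add: poly_eq_poly_eq_iff[symmetric] fun_eq_iff)
qed

lemma order_linear_factor: "order z [:- a, 1:] = (if z = a then 1 else (0::nat))" for a :: complex
proof (cases "z = a")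
  case True
  then show ?thesis using order_power_n_n[of a 1] by (simp only: power_one_right simp_thms if_True)
next
  case False
  then show ?thesis by (simp add: order_0I)
qed

lemma order_prod_linear_factors:
  fixes a :: "'k \<Rightarrow> complex"
  assumes "finite K"
  shows "order z (\<Prod>k\<in>K. [:- a k, 1:]) = card {k \<in> K. a k = z}"
  using assms
proof (induction K rule: finite_induct)
  case (insert k K)
  have "order z (\<Prod>k\<in>insert k K. [:- a k, 1:]) = order z [:- a k, 1:] + order z (\<Prod>k\<in>K. [:- a k, 1:])"
    using insert.hyps by (subst prod.insert) (auto simp: order_mult simp del: mult_pCons_left)
  moreover have "{i \<in> insert k K. a i = z} = (if a k = z then insert k {i \<in> K. a i = z} else {i \<in> K. a i = z})"
    by auto
  ultimately show ?case using insert by (auto simp: order_linear_factor)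
qed (simp add: order_0I)

text \<open>The multiplicity of a root counts the indices at which \<open>a\<close> takes that
  value, so the right-hand sum is the left-hand one ungrouped.\<close>

lemma sum_roots_prod_linear_factors:
  fixes a :: "'k::finite \<Rightarrow> complex"
  defines "p \<equiv> \<Prod>k\<in>UNIV. [:- a k, 1:]"
  shows "(\<Sum>z | poly p z = 0. real (order z p) * cmod z) = (\<Sum>k\<in>UNIV. cmod (a k))"
proof -
  have roots: "{z. poly p z = 0} = range a"
    by (auto simp: p_def poly_prod)
  have order: "order z p = card {k. a k = z}" for z
    by (simp add: p_def order_prod_linear_factors)
  have "real (order z p) * cmod z = (\<Sum>k | k \<in> UNIV \<and> a k = z. cmod (a k))" for z
    by (simp add: order)
  then show ?thesis
    unfolding roots by (simp only: sum.image_gen[of UNIV "\<lambda>k. cmod (a k)" a, OF finite])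
qed

text \<open>If \<open>G = C C\<^sup>\<dagger>\<close> and the unitary \<open>U\<close> diagonalises \<open>C\<^sup>\<dagger> H C\<close>, then \<open>P = C U\<close> satisfies
  \<open>G = P P\<^sup>\<dagger>\<close> and makes \<open>P\<^sup>\<dagger> H P\<close> diagonal, so \<open>G H\<close> is similar to that diagonal matrix.\<close>

lemma sum_abs_eigenvalues_le_trace:
  fixes G K X :: "complex^'n^'n"
  assumes G: "pd_mat G" and H: "hermitian_mat H" and K: "K = mat c ** H" and c: "cmod c = 1"
    and minus: "psd_mat (X - H)" and plus: "psd_mat (X + H)"
  defines "p \<equiv> char_poly_mat (G ** K)"
  shows "(\<Sum>z | poly p z = 0. real (order z p) * cmod z) \<le> Re (trace (G ** X))"
proof -
  have "psd_mat G"
    using G by (rule pd_mat_imp_psd_mat)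
  then obtain C where C: "G = C ** adjoint_mat C" by (rule psd_mat_factor)
  have "hermitian_mat (adjoint_mat C ** H ** C)"
    using H by (simp add: hermitian_mat_def adjoint_mat_mult matrix_mul_assoc)
  then obtain U l where U: "U ** adjoint_mat U = mat 1"
    and D: "adjoint_mat U ** (adjoint_mat C ** H ** C) ** U = real_diag l"
    using hermitian_spectral by blast
  define P where "P = C ** U"
  have PH: "adjoint_mat P ** H ** P = real_diag l"
    using D by (simp add: P_def adjoint_mat_mult matrix_mul_assoc)
  have PP: "P ** adjoint_mat P = G"
  proof -
    have "P ** adjoint_mat P = C ** (U ** adjoint_mat U) ** adjoint_mat C"
      by (simp add: P_def adjoint_mat_mult matrix_mul_assoc)
    then show ?thesis by (simp add: U C)
  qed
  \<comment> \<open>Definiteness makes \<open>G\<close> invertible with inverse \<open>Gi\<close>,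
    and \<open>PP\<close> then shows that \<open>adjoint_mat P ** Gi\<close> inverts
    \<open>P\<close>.\<close>
  have "\<forall>v. G *v v = 0 \<longrightarrow> v = 0"
  proof (intro allI impI)
    fix v assume "G *v v = 0"
    then have "qform G v = 0" by (simp add: qform_eq_cinner cinner_def)
    then show "v = 0" using G by (force simp: pd_mat_def)
  qed
  then obtain Gi where "Gi ** G = mat 1" using matrix_left_invertible_ker[of G] by blast
  then have "P ** (adjoint_mat P ** Gi) = mat 1"
    using PP matrix_left_right_inverse1[of Gi G] by (simp add: matrix_mul_assoc)
  then have inv: "(adjoint_mat P ** Gi) ** P = mat 1" by (rule matrix_left_right_inverse1)
  have "(adjoint_mat P ** Gi) ** (G ** K) ** P = mat c ** real_diag l"
  proof -
    have "(adjoint_mat P ** Gi) ** (G ** K) ** P = adjoint_mat P ** (Gi ** G) ** K ** P"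
      by (simp add: matrix_mul_assoc)
    also have "\<dots> = adjoint_mat P ** mat c ** H ** P"
      unfolding \<open>Gi ** G = mat 1\<close> by (simp add: K matrix_mul_assoc)
    also have "\<dots> = mat c ** (adjoint_mat P ** H ** P)"
      by (simp add: matrix_mul_mat matrix_mul_assoc)
    finally show ?thesis by (simp add: PH)
  qed
  then have "p = (\<Prod>k\<in>UNIV. [:- (c * of_real (l k)), 1:])"
    using char_poly_mat_similar[OF inv, of "G ** K"] by (simp add: p_def char_poly_mat_scaled_diag)
  then have "(\<Sum>z | poly p z = 0. real (order z p) * cmod z) = (\<Sum>k\<in>UNIV. \<bar>l k\<bar>)"
    by (simp add: sum_roots_prod_linear_factors norm_mult c)
  \<comment> \<open>On column \<open>k\<close> of \<open>P\<close> the form of \<open>H\<close> has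
    the value \<open>l k\<close>, so positivity of \<open>X - H\<close> and \<open>X + H\<close>
    bounds \<open>l k\<close> and \<open>- l k\<close> at once.\<close>
  also have "\<dots> \<le> (\<Sum>k\<in>UNIV. Re (qform X (column k P)))"
  proof (rule sum_mono)
    fix k
    have "qform H (column k P) = of_real (l k)"
      unfolding qform_column PH by (simp add: real_diag_def)
    then show "\<bar>l k\<bar> \<le> Re (qform X (column k P))"
      using minus plus by (auto simp: psd_mat_def qform_diff qform_add abs_le_iff algebra_simps
          dest!: spec[of _ "column k P"])
  qed
  also have "\<dots> = Re (trace (adjoint_mat P ** X ** P))"
    by (simp add: trace_conjugate)
  also have "trace (adjoint_mat P ** X ** P) = trace (G ** X)"
    unfolding PP[symmetric] using trace_mul_sym[of "adjoint_mat P ** X" P] by (simp add: matrix_mul_assoc)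
  finally show ?thesis .
qed

section \<open>Information matrices and unbiased estimators\<close>

lemma trace_sum: "trace (\<Sum>k\<in>K. f k) = (\<Sum>k\<in>K. trace (f k :: 'a::comm_semiring_1^'n^'n))"
  unfolding trace_def sum_component by (rule sum.swap)

lemma matrix_mult_sum_right: "A ** (\<Sum>k\<in>K. f k) = (\<Sum>k\<in>K. (A :: complex^'n^'n) ** f k)"
  by (simp add: vec_eq_iff matrix_matrix_mult_def sum_distrib_left) (intro allI sum.swap)

lemma matrix_mult_sum_left: "(\<Sum>k\<in>K. f k) ** A = (\<Sum>k\<in>K. f k ** (A :: complex^'n^'n))"
  by (simp add: vec_eq_iff matrix_matrix_mult_def sum_distrib_right) (intro allI sum.swap)

lemma adjoint_mat_sum: "adjoint_mat (\<Sum>k\<in>K. f k) = (\<Sum>k\<in>K. adjoint_mat (f k))"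
  by (simp add: vec_eq_iff)

lemma trace_scaleR_mult: "trace ((r *\<^sub>R A) ** B) = of_real r * trace (A ** (B :: complex^'n^'n))"
  by (simp add: trace_def matrix_matrix_mult_def sum_distrib_left scaleR_conv_of_real[where 'a=complex] mult_ac)

lemma matrix_inv_inverse:
  assumes "invertible A"
  shows "A ** matrix_inv A = mat 1" "matrix_inv A ** A = mat 1"
  using someI_ex[OF assms[unfolded invertible_def]] by (simp_all add: matrix_inv_def)

text \<open>\<open>*\<^sub>R\<close> scales by real numbers only, so the complex coefficients enter
  as scalar matrices.\<close>

definition lincomb :: "complex^'m \<Rightarrow> ('m \<Rightarrow> complex^'d^'d) \<Rightarrow> complex^'d^'d" where
  "lincomb d L = (\<Sum>k\<in>UNIV. mat (d $ k) ** L k)"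

lemma trace_mult_lincomb:
  "trace ((A :: complex^'d^'d) ** lincomb d L ** X) = (\<Sum>k\<in>UNIV. d $ k * trace (A ** L k ** X))"
proof -
  have "A ** (mat (d $ k) ** L k) ** X = mat (d $ k) ** (A ** L k ** X)" for k
    by (simp add: matrix_mul_assoc matrix_mul_mat)
  then show ?thesis
    unfolding lincomb_def matrix_mult_sum_right matrix_mult_sum_left trace_sum
    by (simp only: trace_mat_mult)
qed

text \<open>\<open>JR_mat\<close> is the Gram matrix of the operators for a form weighted by
  \<open>\<rho>\<close>. Its quadratic form is therefore the term in \<open>L\<close> of
  \<open>estimator_bound\<close>.\<close>

lemma qform_JR_mat: "qform (JR_mat \<rho> L) d = trace (\<rho> ** lincomb d L ** adjoint_mat (lincomb d L))"
proof -
  have "A ** adjoint_mat (mat c ** B) = mat (cnj c) ** (A ** adjoint_mat B)" for A B :: "complex^'b^'b" and c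
    by (simp add: adjoint_mat_mult matrix_mul_assoc matrix_mul_mat)
  then have "trace (\<rho> ** lincomb d L ** adjoint_mat (lincomb d L))
      = (\<Sum>j\<in>UNIV. d $ j * (\<Sum>i\<in>UNIV. cnj (d $ i) * trace (\<rho> ** L j ** adjoint_mat (L i))))"
    unfolding trace_mult_lincomb
    by (simp add: lincomb_def adjoint_mat_sum matrix_mult_sum_right trace_sum trace_mat_mult)
  also have "\<dots> = qform (JR_mat \<rho> L) d"
    unfolding qform_def JR_mat_def sum_distrib_left by (subst sum.swap) (simp add: mult_ac)
  finally show ?thesis by simp
qed

lemma hermitian_JR_mat:
  assumes "hermitian_mat \<rho>" shows "hermitian_mat (JR_mat \<rho> L)"
proof -
  have "cnj (trace (\<rho> ** A ** adjoint_mat B)) = trace (\<rho> ** B ** adjoint_mat A)" for A B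
  proof -
    have "cnj (trace (\<rho> ** A ** adjoint_mat B)) = trace ((B ** adjoint_mat A) ** \<rho>)"
      unfolding trace_adjoint_mat[symmetric]
      using assms by (simp add: adjoint_mat_mult hermitian_mat_def matrix_mul_assoc)
    also have "\<dots> = trace (\<rho> ** (B ** adjoint_mat A))" by (rule trace_mul_sym)
    finally show ?thesis by (simp add: matrix_mul_assoc)
  qed
  then show ?thesis by (simp add: hermitian_mat_def vec_eq_iff JR_mat_def)
qed

text \<open>Symmetrising the Gram matrix averages each entry with its conjugate. This lets
  \<open>qform_JR_mat\<close> serve the symmetric case too.\<close>

lemma JS_mat_eq_Re_JR_mat:
  assumes \<rho>: "hermitian_mat \<rho>" and L: "\<And>i. hermitian_mat (L i)"
  shows "JS_mat \<rho> L $ i $ j = of_real (Re (JR_mat \<rho> L $ i $ j))"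
proof -
  have "JS_mat \<rho> L $ i $ j = (1/2) * (JR_mat \<rho> L $ i $ j + JR_mat \<rho> L $ j $ i)"
    using L by (simp add: JS_mat_def JR_mat_def hermitian_mat_def matrix_add_ldistrib trace_add matrix_mul_assoc add.commute)
  moreover have "JR_mat \<rho> L $ j $ i = cnj (JR_mat \<rho> L $ i $ j)"
    using hermitian_JR_mat[OF \<rho>, of L] unfolding hermitian_mat_def by (metis adjoint_mat_nth)
  ultimately show ?thesis by (simp add: complex_eq_iff)
qed

lemma hermitian_matrix_inv:
  assumes "hermitian_mat J" "invertible J" shows "hermitian_mat (matrix_inv J)"
proof -
  have left: "adjoint_mat (matrix_inv J) ** J = mat 1"
    using arg_cong[OF matrix_inv_inverse(1)[OF assms(2)], of adjoint_mat] assms(1)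
    by (simp add: adjoint_mat_mult hermitian_mat_def)
  have "adjoint_mat (matrix_inv J) = adjoint_mat (matrix_inv J) ** (J ** matrix_inv J)"
    by (simp add: matrix_inv_inverse(1)[OF assms(2)])
  also have "\<dots> = matrix_inv J"
    by (simp add: matrix_mul_assoc left)
  finally show ?thesis by (simp add: hermitian_mat_def)
qed

text \<open>The entrywise conjugate of the inverse is again a left inverse of the real matrix
  \<open>J\<close>, hence equal to the inverse.\<close>

lemma matrix_inv_real_entries:
  fixes J :: "complex^'n^'n"
  assumes "invertible J" and J: "\<And>i j. J $ i $ j \<in> \<real>"
  shows "matrix_inv J $ i $ j \<in> \<real>"
proof -
  define C where "C = (\<chi> i j. cnj (matrix_inv J $ i $ j))"
  have "C ** J = mat 1"
  proof -
    have "cnj ((matrix_inv J ** J) $ i $ j) = (C ** J) $ i $ j" for i j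
      using J by (simp add: C_def matrix_matrix_mult_def Reals_cnj_iff)
    then have "(C ** J) $ i $ j = cnj (mat 1 $ i $ j)" for i j
      by (simp add: matrix_inv_inverse[OF assms(1)])
    then show ?thesis by (simp add: vec_eq_iff mat_def)
  qed
  then have "C ** (J ** matrix_inv J) = matrix_inv J"
    by (simp add: matrix_mul_assoc)
  then have "C = matrix_inv J"
    by (simp add: matrix_inv_inverse[OF assms(1)])
  then have "cnj (matrix_inv J $ i $ j) = matrix_inv J $ i $ j"
    by (simp add: C_def vec_eq_iff)
  then show ?thesis by (simp add: Reals_cnj_iff)
qed

section \<open>Real matrices acting on complex vectors\<close>

definition Re_vec :: "complex^'n \<Rightarrow> real^'n" where "Re_vec v = (\<chi> i. Re (v $ i))"
definition Im_vec :: "complex^'n \<Rightarrow> real^'n" where "Im_vec v = (\<chi> i. Im (v $ i))"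
definition cvec_of_real :: "real^'n \<Rightarrow> complex^'n" where "cvec_of_real x = (\<chi> i. of_real (x $ i))"

text \<open>Terms mixing real and imaginary parts of \<open>v\<close> are purely imaginary.
  Positivity can therefore be tested on real vectors, the only ones available in the symmetric
  case.\<close>

lemma Re_qform_cmat_of_real:
  "Re (qform (cmat_of_real A) v) = Re_vec v \<bullet> (A *v Re_vec v) + Im_vec v \<bullet> (A *v Im_vec v)"
  by (simp add: qform_def cmat_of_real_def Re_vec_def Im_vec_def inner_vec_def matrix_vector_mult_def
      sum_distrib_left sum.distrib[symmetric] algebra_simps)

lemma psd_cmat_of_real:
  assumes "transpose A = A" and "\<And>x. 0 \<le> Re (qform (cmat_of_real A) (cvec_of_real x))"
  shows "psd_mat (cmat_of_real A)"
proof -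
  have "Re (qform (cmat_of_real A) (cvec_of_real x)) = x \<bullet> (A *v x)" for x
  proof -
    have "Re_vec (cvec_of_real x) = x" "Im_vec (cvec_of_real x) = 0"
      by (simp_all add: vec_eq_iff Re_vec_def Im_vec_def cvec_of_real_def)
    then show ?thesis by (simp add: Re_qform_cmat_of_real)
  qed
  with assms(2) have "0 \<le> Re (qform (cmat_of_real A) v)" for v
    by (simp add: Re_qform_cmat_of_real)
  moreover have "hermitian_mat (cmat_of_real A)"
    using assms(1) by (simp add: hermitian_mat_def vec_eq_iff cmat_of_real_def transpose_def)
  ultimately show ?thesis by (simp add: psd_mat_def)
qed

lemma pd_cmat_of_real:
  assumes "real_pd_mat G" shows "pd_mat (cmat_of_real G)"
proof -
  have nonneg: "0 \<le> x \<bullet> (G *v x)" and pos: "x \<noteq> 0 \<Longrightarrow> 0 < x \<bullet> (G *v x)" for x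
    using assms by (cases "x = 0"; force simp: real_pd_mat_def)+
  have "0 < Re (qform (cmat_of_real G) v)" if "v \<noteq> 0" for v
  proof -
    have "Re_vec v \<noteq> 0 \<or> Im_vec v \<noteq> 0"
      using that by (auto simp: vec_eq_iff Re_vec_def Im_vec_def complex_eq_iff)
    then show ?thesis
      unfolding Re_qform_cmat_of_real using nonneg pos
      by (metis add_pos_nonneg add_nonneg_pos)
  qed
  moreover have "hermitian_mat (cmat_of_real G)"
    using assms by (simp add: hermitian_mat_def vec_eq_iff cmat_of_real_def real_pd_mat_def transpose_def)
  ultimately show ?thesis by (simp add: pd_mat_def)
qed

lemma qform_conj: "qform (\<chi> i j. cnj (A $ i $ j)) v = cnj (qform A (\<chi> i. cnj (v $ i)))"
  by (simp add: qform_def)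

lemma psd_mat_conj: "psd_mat A \<Longrightarrow> psd_mat (\<chi> i j. cnj (A $ i $ j))"
  by (simp add: psd_mat_def qform_conj) (simp add: hermitian_mat_def vec_eq_iff)

section \<open>Moments and complex linear functionals of the outcome\<close>

lemma integrable_norm_of_components:
  fixes f :: "'a \<Rightarrow> real^'m"
  assumes meas: "f \<in> borel_measurable N" and f: "\<And>i. integrable N (\<lambda>x. f x $ i)"
  shows "integrable N (\<lambda>x. norm (f x))"
proof (rule Bochner_Integration.integrable_bound)
  show "integrable N (\<lambda>x. \<Sum>i\<in>UNIV. \<bar>f x $ i\<bar>)" using f by auto
  show "AE x in N. norm (norm (f x)) \<le> norm (\<Sum>i\<in>UNIV. \<bar>f x $ i\<bar>)"
    using norm_le_l1_cart[of "f _"] by (intro AE_I2) (simp add: sum_nonneg)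
qed (use meas in measurable)

lemma norm_vec_square: "(norm x)\<^sup>2 = (\<Sum>i\<in>UNIV. (x $ i)\<^sup>2)" for x :: "real^'m"
  by (simp add: norm_vec_def L2_set_def sum_nonneg)

lemma integrable_mult_of_squares:
  fixes f g :: "'a \<Rightarrow> real"
  assumes "f \<in> borel_measurable N" "g \<in> borel_measurable N"
    and "integrable N (\<lambda>x. (f x)\<^sup>2)" "integrable N (\<lambda>x. (g x)\<^sup>2)"
  shows "integrable N (\<lambda>x. f x * g x)"
proof (rule Bochner_Integration.integrable_bound)
  show "integrable N (\<lambda>x. (f x)\<^sup>2 + (g x)\<^sup>2)" using assms by auto
  have "\<bar>a * b\<bar> \<le> a\<^sup>2 + b\<^sup>2" for a b :: real
    using sum_squares_bound[of "\<bar>a\<bar>" "\<bar>b\<bar>"] abs_ge_zero[of "a * b"] unfolding abs_mult power2_abs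
    by linarith
  then show "AE x in N. norm (f x * g x) \<le> norm ((f x)\<^sup>2 + (g x)\<^sup>2)"
    by (intro AE_I2) (simp del: abs_mult)
qed (use assms in measurable)

text \<open>The weights are conjugated so that the coefficients \<open>d\<close> pair with the
  differences of means to \<open>cinner w d\<close>.\<close>

definition cfunctional :: "complex^'m \<Rightarrow> real^'m \<Rightarrow> complex" where
  "cfunctional w v = (\<Sum>j\<in>UNIV. cnj (w $ j) * of_real (v $ j))"

lemma bounded_linear_cfunctional: "bounded_linear (cfunctional w)"
  unfolding cfunctional_def
  by (intro bounded_linear_sum bounded_linear_const_mult bounded_linear_compose[OF bounded_linear_of_real]
      bounded_linear_vec_nth)

lemma cfunctional_axis: "cfunctional w (r *\<^sub>R axis k 1) = of_real r * cnj (w $ k)"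
proof -
  have "cfunctional w (r *\<^sub>R axis k 1) = (\<Sum>j\<in>UNIV. if j = k then of_real r * cnj (w $ k) else 0)"
    unfolding cfunctional_def by (intro sum.cong) (auto simp: axis_def)
  then show ?thesis by simp
qed

lemma cmod_cfunctional_square:
  "(cmod (cfunctional w v))\<^sup>2 = (\<Sum>i\<in>UNIV. \<Sum>j\<in>UNIV. Re (cnj (w $ i) * w $ j) * (v $ i * v $ j))"
proof -
  have "of_real ((cmod (cfunctional w v))\<^sup>2) = cfunctional w v * cnj (cfunctional w v)"
    by (rule complex_norm_square)
  also have "\<dots> = (\<Sum>i\<in>UNIV. \<Sum>j\<in>UNIV. (cnj (w $ i) * w $ j) * of_real (v $ i * v $ j))"
    unfolding cfunctional_def cnj_sum sum_product by (simp add: mult_ac)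
  finally have "(cmod (cfunctional w v))\<^sup>2 = Re (\<Sum>i\<in>UNIV. \<Sum>j\<in>UNIV. (cnj (w $ i) * w $ j) * of_real (v $ i * v $ j))"
    by (metis Re_complex_of_real)
  moreover have "Re (z * of_real r) = Re z * r" for z r by simp
  ultimately show ?thesis by (simp only: Re_sum)
qed

text \<open>This applies \<open>estimator_bound\<close> to the shifted states with coefficients
  \<open>d $ k / \<delta> $ k\<close>. Unbiasedness evaluates the left side, and the second moments
  under \<open>\<rho> \<theta>\<close> assemble into the covariance form.\<close>

lemma unbiased_estimator_bound:
  fixes \<rho> :: "real^'m \<Rightarrow> complex^'d^'d" and M :: "(real^'m) set \<Rightarrow> complex^'d^'d"
  assumes model: "\<forall>\<theta>'\<in>\<Theta>. density_op (\<rho> \<theta>')"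
    and theta_in: "\<theta> \<in> \<Theta>"
    and delta_nz: "\<forall>i. \<delta> $ i \<noteq> 0"
    and pts_in: "\<forall>i. \<theta> + (t $ i * \<delta> $ i) *\<^sub>R axis i 1 \<in> \<Theta> \<and>
                     \<theta> - ((1 - t $ i) * \<delta> $ i) *\<^sub>R axis i 1 \<in> \<Theta>"
    and povm: "povm M"
    and unb: "unbiased \<rho> \<Theta> M"
    and second_moments: "\<forall>i. integrable (outcome_measure (\<rho> \<theta>) M) (\<lambda>x. (x $ i - \<theta> $ i)^2)"
    and pairing: "\<And>v X. psd_mat X \<Longrightarrow> Re (cfunctional w v * trace (\<rho> \<theta> ** L ** X))
      = Re (cfunctional w v * (\<Sum>k\<in>UNIV. d $ k * trace (fin_diff \<rho> (t $ k) k (\<delta> $ k) \<theta> ** X)))"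
  shows "2 * Re (cinner w d) \<le> Re (trace (\<rho> \<theta> ** L ** adjoint_mat L)) + Re (qform (cmat_of_real (cov_mat \<rho> \<theta> M)) w)"
proof -
  define A where "A k = \<rho> (\<theta> + (t $ k * \<delta> $ k) *\<^sub>R axis k 1)" for k
  define B where "B k = \<rho> (\<theta> - ((1 - t $ k) * \<delta> $ k) *\<^sub>R axis k 1)" for k
  have psd: "psd_mat (\<rho> \<theta>')" and tr: "trace (\<rho> \<theta>') = 1" if "\<theta>' \<in> \<Theta>" for \<theta>'
    using model that by (auto simp: density_op_def)
  have meas_eq: "borel_measurable (outcome_measure E M) = borel_measurable borel" for E
    by (rule measurable_cong_sets) simp_all
  have prob: "measure (outcome_measure (\<rho> \<theta>') M) UNIV = 1"
    and emeas: "finite_measure (outcome_measure (\<rho> \<theta>') M)" if "\<theta>' \<in> \<Theta>" for \<theta>'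
    using measure_outcome_measure[OF psd[OF that] povm, of UNIV] tr[OF that]
    by (simp_all add: povm_UNIV[OF povm] finite_measure_outcome_measure[OF psd[OF that] povm])
  have int_comp: "integrable (outcome_measure (\<rho> \<theta>') M) (\<lambda>x. (x - \<theta>) $ i)"
    and mean: "(\<integral>x. (x - \<theta>) $ i \<partial>outcome_measure (\<rho> \<theta>') M) = (\<theta>' - \<theta>) $ i" if "\<theta>' \<in> \<Theta>" for \<theta>' i
  proof -
    interpret finite_measure "outcome_measure (\<rho> \<theta>') M" by (rule emeas[OF that])
    have "integrable (outcome_measure (\<rho> \<theta>') M) (\<lambda>x. x $ i)"
      "(\<integral>x. x $ i \<partial>outcome_measure (\<rho> \<theta>') M) = \<theta>' $ i"
      using unb that by (auto simp: unbiased_def)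
    then show "integrable (outcome_measure (\<rho> \<theta>') M) (\<lambda>x. (x - \<theta>) $ i)"
      "(\<integral>x. (x - \<theta>) $ i \<partial>outcome_measure (\<rho> \<theta>') M) = (\<theta>' - \<theta>) $ i"
      using prob[OF that] by simp_all
  qed
  have int_norm: "integrable (outcome_measure (\<rho> \<theta>') M) (\<lambda>x. norm (x - \<theta>))" if "\<theta>' \<in> \<Theta>" for \<theta>'
    by (rule integrable_norm_of_components[OF _ int_comp[OF that]]) (simp add: meas_eq)
  have int_sq: "integrable (outcome_measure (\<rho> \<theta>) M) (\<lambda>x. (norm (x - \<theta>))\<^sup>2)"
    using second_moments by (simp add: norm_vec_square)
  have mean_h: "(\<integral>x. cfunctional w (x - \<theta>) \<partial>outcome_measure (\<rho> \<theta>') M) = cfunctional w (\<theta>' - \<theta>)" if "\<theta>' \<in> \<Theta>" for \<theta>'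
    unfolding cfunctional_def
    using int_comp[OF that] mean[OF that] by (simp del: vector_minus_component of_real_diff)
  have diff: "(\<integral>x. cfunctional w (x - \<theta>) \<partial>outcome_measure (A k) M) - (\<integral>x. cfunctional w (x - \<theta>) \<partial>outcome_measure (B k) M)
      = of_real (\<delta> $ k) * cnj (w $ k)" for k
  proof -
    have "(\<integral>x. cfunctional w (x - \<theta>) \<partial>outcome_measure (A k) M) - (\<integral>x. cfunctional w (x - \<theta>) \<partial>outcome_measure (B k) M)
        = cfunctional w ((t $ k * \<delta> $ k) *\<^sub>R axis k 1) - cfunctional w ((- ((1 - t $ k) * \<delta> $ k)) *\<^sub>R axis k 1)"
      using pts_in by (simp add: A_def B_def mean_h)
    \<comment> \<open>The two offsets \<open>t $ k * \<delta> $ k\<close> and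
      \<open>(1 - t $ k) * \<delta> $ k\<close> add up to \<open>\<delta> $ k\<close>, so
      \<open>t\<close> drops out.\<close>
    also have "\<dots> = of_real (\<delta> $ k) * cnj (w $ k)"
      unfolding cfunctional_axis by (simp add: algebra_simps)
    finally show ?thesis .
  qed
  have "2 * Re (\<Sum>k\<in>UNIV. (d $ k / of_real (\<delta> $ k)) * ((\<integral>x. cfunctional w (x - \<theta>) \<partial>outcome_measure (A k) M)
        - (\<integral>x. cfunctional w (x - \<theta>) \<partial>outcome_measure (B k) M)))
      \<le> Re (trace (\<rho> \<theta> ** L ** adjoint_mat L)) + (\<integral>x. (cmod (cfunctional w (x - \<theta>)))\<^sup>2 \<partial>outcome_measure (\<rho> \<theta>) M)"
  proof (rule estimator_bound[OF povm psd[OF theta_in] bounded_linear_cfunctional _ _ _ _ int_sq])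
    fix v and X :: "complex^'d^'d" assume X: "psd_mat X"
    have "d $ k * trace (fin_diff \<rho> (t $ k) k (\<delta> $ k) \<theta> ** X)
        = d $ k / of_real (\<delta> $ k) * (trace (A k ** X) - trace (B k ** X))" for k
      unfolding fin_diff_def A_def B_def
      by (simp add: trace_scaleR_mult matrix_diff_rdistrib trace_sub)
    then show "Re (cfunctional w v * trace (\<rho> \<theta> ** L ** X)) = Re (cfunctional w v *
        (\<Sum>k\<in>UNIV. d $ k / of_real (\<delta> $ k) * (trace (A k ** X) - trace (B k ** X))))"
      using pairing[OF X] by simp
  qed (use pts_in psd int_norm in \<open>auto simp: A_def B_def\<close>)
  moreover have "(\<Sum>k\<in>UNIV. (d $ k / of_real (\<delta> $ k)) * ((\<integral>x. cfunctional w (x - \<theta>) \<partial>outcome_measure (A k) M)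
        - (\<integral>x. cfunctional w (x - \<theta>) \<partial>outcome_measure (B k) M))) = cinner w d"
    unfolding diff cinner_def using delta_nz by (intro sum.cong) (auto simp: mult.commute)
  moreover have "(\<integral>x. (cmod (cfunctional w (x - \<theta>)))\<^sup>2 \<partial>outcome_measure (\<rho> \<theta>) M)
      = Re (qform (cmat_of_real (cov_mat \<rho> \<theta> M)) w)"
  proof -
    \<comment> \<open>A Bochner integral that fails to exist has the value 0, so the mixed moments
      must be integrable before the square may be expanded under the integral.\<close>
    have int: "integrable (outcome_measure (\<rho> \<theta>) M) (\<lambda>x. (x $ i - \<theta> $ i) * (x $ j - \<theta> $ j))" for i j
      by (rule integrable_mult_of_squares) (use second_moments in \<open>auto simp: meas_eq\<close>)
    have "(\<integral>x. (cmod (cfunctional w (x - \<theta>)))\<^sup>2 \<partial>outcome_measure (\<rho> \<theta>) M)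
        = (\<Sum>i\<in>UNIV. \<Sum>j\<in>UNIV. Re (cnj (w $ i) * w $ j) * cov_mat \<rho> \<theta> M $ i $ j)"
      unfolding cmod_cfunctional_square cov_mat_def vec_lambda_beta vector_minus_component
      using int by (simp only: Bochner_Integration.integral_sum Bochner_Integration.integrable_sum
          integrable_mult_right integral_mult_right_zero)
    also have "\<dots> = Re (qform (cmat_of_real (cov_mat \<rho> \<theta> M)) w)"
      by (simp add: qform_def cmat_of_real_def algebra_simps)
    finally show ?thesis .
  qed
  ultimately show ?thesis by (simp only:)
qed

text \<open>At \<open>d = matrix_inv J *v w\<close> both \<open>cinner w d\<close> and the form of
  \<open>J\<close> equal the form of the inverse at \<open>w\<close>; one of the two copies on the
  left cancels.\<close>

lemma qform_matrix_inv_le: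
  assumes J: "hermitian_mat J" "invertible J"
    and bound: "2 * Re (cinner w (matrix_inv J *v w)) \<le> Re (qform J (matrix_inv J *v w)) + Re (qform V w)"
  shows "Re (qform (matrix_inv J) w) \<le> Re (qform V w)"
proof -
  have "qform J (matrix_inv J *v w) = cinner (matrix_inv J *v w) w"
    by (simp add: qform_eq_cinner matrix_vector_mul_assoc matrix_inv_inverse[OF J(2)])
  also have "\<dots> = qform (matrix_inv J) w"
    using hermitian_matrix_inv[OF J] by (simp add: cinner_matrix_left hermitian_mat_def qform_eq_cinner)
  finally show ?thesis using bound by (simp add: qform_eq_cinner)
qed

text \<open>\<open>second_moments\<close> expresses that the covariance matrix is finite. The traces
  of \<open>G\<close> against the inverse information matrices are real, both factors being
  Hermitian, so \<open>Re\<close> only changes their type.\<close>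

theorem theorem5:
  fixes \<rho> :: "real^'m \<Rightarrow> complex^'d^'d"
    and \<Theta> :: "(real^'m) set"
    and \<theta> \<delta> t :: "real^'m"
    and LS LR :: "'m \<Rightarrow> complex^'d^'d"
    and M :: "(real^'m) set \<Rightarrow> complex^'d^'d"
    and G :: "real^'m^'m"
  assumes model: "\<forall>\<theta>'\<in>\<Theta>. density_op (\<rho> \<theta>') \<and> pd_mat (\<rho> \<theta>')"
    and theta_in: "\<theta> \<in> \<Theta>"
    and delta_nz: "\<forall>i. \<delta> $ i \<noteq> 0"
    and t_range: "\<forall>i. 0 \<le> t $ i \<and> t $ i \<le> 1"
    and pts_in: "\<forall>i. \<theta> + (t $ i * \<delta> $ i) *\<^sub>R axis i 1 \<in> \<Theta> \<and>
                     \<theta> - ((1 - t $ i) * \<delta> $ i) *\<^sub>R axis i 1 \<in> \<Theta>"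
    and LS_herm: "\<forall>i. hermitian_mat (LS i)"
    and LS_eq: "\<forall>i. fin_diff \<rho> (t $ i) i (\<delta> $ i) \<theta> = (1/2) *\<^sub>R (LS i ** \<rho> \<theta> + \<rho> \<theta> ** LS i)"
    and LR_eq: "\<forall>i. fin_diff \<rho> (t $ i) i (\<delta> $ i) \<theta> = \<rho> \<theta> ** LR i"
    and JS_inv: "invertible (JS_mat (\<rho> \<theta>) LS)"
    and JR_inv: "invertible (JR_mat (\<rho> \<theta>) LR)"
    and povm: "povm M"
    and unb: "unbiased \<rho> \<Theta> M"
    and second_moments: "\<forall>i. integrable (outcome_measure (\<rho> \<theta>) M) (\<lambda>x. (x $ i - \<theta> $ i)^2)"
    and G_pd: "real_pd_mat G"
  shows "trace (G ** cov_mat \<rho> \<theta> M) \<ge> Re (trace (cmat_of_real G ** matrix_inv (JS_mat (\<rho> \<theta>) LS)))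
       \<and> trace (G ** cov_mat \<rho> \<theta> M) \<ge> Re (trace (cmat_of_real G ** matrix_inv (JR_mat (\<rho> \<theta>) LR)))
            + Spabs (Im_mat (cmat_of_real G ** matrix_inv (JR_mat (\<rho> \<theta>) LR)))"
proof -
  have density: "\<forall>\<theta>'\<in>\<Theta>. density_op (\<rho> \<theta>')" using model by blast
  note bound = unbiased_estimator_bound[OF density theta_in delta_nz pts_in povm unb second_moments]
  have herm: "hermitian_mat (\<rho> \<theta>)"
    using density theta_in by (auto simp: density_op_def psd_mat_def)
  define V where "V = cov_mat \<rho> \<theta> M"
  define JS where "JS = JS_mat (\<rho> \<theta>) LS"
  define JR where "JR = JR_mat (\<rho> \<theta>) LR"
  have V_sym: "transpose V = V"
    by (simp add: V_def cov_mat_def transpose_def vec_eq_iff mult.commute)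
  have G_psd: "pd_mat (cmat_of_real G)" by (rule pd_cmat_of_real[OF G_pd])
  have trace_GV: "Re (trace (cmat_of_real G ** cmat_of_real A)) = trace (G ** A)" for A
    by (simp add: trace_def matrix_matrix_mult_def cmat_of_real_def)
  have Re_trace: "Re (trace (cmat_of_real G ** A)) = trace (G ** (\<chi> i j. Re (A $ i $ j)))" for A
    by (simp add: trace_def matrix_matrix_mult_def cmat_of_real_def)
  have cmat_diff: "cmat_of_real (A - B) = cmat_of_real A - cmat_of_real B" for A B :: "real^'m^'m"
    by (simp add: vec_eq_iff cmat_of_real_def)

  have SLD: "trace (G ** V) \<ge> Re (trace (cmat_of_real G ** matrix_inv JS))"
  proof -
    have JS_real: "JS $ i $ j = of_real (Re (JR_mat (\<rho> \<theta>) LS $ i $ j))" for i j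
      unfolding JS_def using JS_mat_eq_Re_JR_mat[OF herm] LS_herm by blast
    have JS_herm: "hermitian_mat JS"
      using hermitian_JR_mat[OF herm, of LS] by (auto simp: hermitian_mat_def vec_eq_iff JS_real complex_eq_iff)
    \<comment> \<open>The symmetric information matrix is real, so its inverse is too and
      \<open>W\<close> is that inverse as a real matrix.\<close>
    define W where "W = (\<chi> i j. Re (matrix_inv JS $ i $ j))"
    have W: "cmat_of_real W = matrix_inv JS"
      using matrix_inv_real_entries[OF JS_inv] JS_real
      by (simp add: vec_eq_iff cmat_of_real_def W_def JS_def)
    have "psd_mat (cmat_of_real (V - W))"
    proof (rule psd_cmat_of_real)
      have "Re (matrix_inv JS $ j $ i) = Re (matrix_inv JS $ i $ j)" for i j
        using hermitian_matrix_inv[OF JS_herm JS_inv[folded JS_def]]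
        unfolding hermitian_mat_def by (metis adjoint_mat_nth cnj.sel(1))
      then show "transpose (V - W) = V - W"
        using V_sym by (simp add: vec_eq_iff transpose_def W_def)
    next
      fix x :: "real^'m"
      let ?w = "cvec_of_real x"
      let ?d = "matrix_inv JS *v ?w"
      have d: "?d = cvec_of_real (W *v x)"
        unfolding W[symmetric]
        by (simp add: vec_eq_iff matrix_vector_mult_def cmat_of_real_def cvec_of_real_def)
      let ?L = "lincomb ?d LS"
      have cf: "cfunctional ?w v = of_real (x \<bullet> v)" for v
        by (simp add: cfunctional_def cvec_of_real_def inner_vec_def)
      have "2 * Re (cinner ?w ?d) \<le> Re (trace (\<rho> \<theta> ** ?L ** adjoint_mat ?L)) + Re (qform (cmat_of_real V) ?w)"
        unfolding V_def
      proof (rule bound)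
        fix v and X :: "complex^'d^'d" assume "psd_mat X"
        then have X: "adjoint_mat X = X" by (simp add: psd_mat_def hermitian_mat_def)
        \<comment> \<open>The symmetric equation fixes only the real part of this trace, as the
          average of the trace and its conjugate. That suffices because \<open>cf\<close> and
          \<open>d\<close> make all weights real.\<close>
        have "Re (trace (\<rho> \<theta> ** LS k ** X)) = Re (trace (fin_diff \<rho> (t $ k) k (\<delta> $ k) \<theta> ** X))" for k
        proof -
          have "cnj (trace (\<rho> \<theta> ** LS k ** X)) = trace (X ** (LS k ** \<rho> \<theta>))"
            unfolding trace_adjoint_mat[symmetric]
            using LS_herm herm X by (simp add: adjoint_mat_mult hermitian_mat_def)
          also have "\<dots> = trace (LS k ** \<rho> \<theta> ** X)" by (rule trace_mul_sym)
          finally have "trace (fin_diff \<rho> (t $ k) k (\<delta> $ k) \<theta> ** X)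
              = (1/2) * (cnj (trace (\<rho> \<theta> ** LS k ** X)) + trace (\<rho> \<theta> ** LS k ** X))"
            using LS_eq by (simp add: trace_scaleR_mult matrix_add_rdistrib trace_add)
          from arg_cong[OF this, of Re] show ?thesis by simp
        qed
        then show "Re (cfunctional ?w v * trace (\<rho> \<theta> ** ?L ** X)) = Re (cfunctional ?w v *
            (\<Sum>k\<in>UNIV. ?d $ k * trace (fin_diff \<rho> (t $ k) k (\<delta> $ k) \<theta> ** X)))"
          unfolding trace_mult_lincomb cf d by (simp add: cvec_of_real_def)
      qed
      also have "Re (trace (\<rho> \<theta> ** ?L ** adjoint_mat ?L)) = Re (qform (JR_mat (\<rho> \<theta>) LS) ?d)"
        by (simp add: qform_JR_mat)
      also have "\<dots> = Re (qform JS ?d)"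
        unfolding d by (simp add: qform_def cvec_of_real_def JS_real)
      finally have "Re (qform (matrix_inv JS) ?w) \<le> Re (qform (cmat_of_real V) ?w)"
        using qform_matrix_inv_le[OF JS_herm JS_inv[folded JS_def]] by blast
      then show "0 \<le> Re (qform (cmat_of_real (V - W)) ?w)"
        by (simp add: cmat_diff W qform_diff)
    qed
    then have "0 \<le> Re (trace (cmat_of_real G ** cmat_of_real (V - W)))"
      using pd_mat_imp_psd_mat[OF G_psd] by (intro trace_psd_mult_nonneg)
    then show ?thesis
      by (simp add: cmat_diff W matrix_diff_ldistrib trace_sub trace_GV)
  qed

  have RLD: "trace (G ** V) \<ge> Re (trace (cmat_of_real G ** matrix_inv JR)) + Spabs (Im_mat (cmat_of_real G ** matrix_inv JR))"
  proof -
    define Ji where "Ji = matrix_inv JR"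
    have JR_herm: "hermitian_mat JR" unfolding JR_def by (rule hermitian_JR_mat[OF herm])
    have Ji_herm: "hermitian_mat Ji"
      unfolding Ji_def using JR_herm JR_inv[folded JR_def] by (rule hermitian_matrix_inv)
    have Ji_nth: "Ji $ j $ i = cnj (Ji $ i $ j)" for i j
      using Ji_herm unfolding hermitian_mat_def by (metis adjoint_mat_nth)
    have "Re (qform Ji w) \<le> Re (qform (cmat_of_real V) w)" for w
      unfolding Ji_def
    proof (rule qform_matrix_inv_le[OF JR_herm JR_inv[folded JR_def]])
      let ?d = "matrix_inv JR *v w"
      \<comment> \<open>The right equation matches the traces exactly, so every complex
        \<open>w\<close> is admissible here.\<close>
      have "2 * Re (cinner w ?d) \<le> Re (trace (\<rho> \<theta> ** lincomb ?d LR ** adjoint_mat (lincomb ?d LR))) + Re (qform (cmat_of_real V) w)"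
        unfolding V_def by (rule bound) (simp add: trace_mult_lincomb LR_eq)
      then show "2 * Re (cinner w ?d) \<le> Re (qform JR ?d) + Re (qform (cmat_of_real V) w)"
        by (simp add: JR_def qform_JR_mat)
    qed
    moreover have "hermitian_mat (cmat_of_real V - Ji)"
    proof -
      have "adjoint_mat (cmat_of_real V) = cmat_of_real V"
        using V_sym by (simp add: vec_eq_iff cmat_of_real_def transpose_def)
      then show ?thesis using Ji_herm by (simp add: hermitian_mat_def adjoint_mat_diff)
    qed
    ultimately have psd: "psd_mat (cmat_of_real V - Ji)"
      by (simp add: psd_mat_def qform_diff)
    \<comment> \<open>\<open>V - Ji\<close> is split into its real part \<open>X\<close> and the
      Hermitian matrix \<open>H\<close>, which is \<open>\<i>\<close> times the imaginary part of
      \<open>Ji\<close>. Since \<open>V\<close> is real, entrywise conjugation only flips the sign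
      of \<open>H\<close>.\<close>
    define X where "X = cmat_of_real (V - (\<chi> i j. Re (Ji $ i $ j)))"
    define K where "K = cmat_of_real (Im_mat Ji)"
    define H where "H = mat \<i> ** K"
    have H_nth: "H $ i $ j = \<i> * of_real (Im (Ji $ i $ j))" for i j
      by (simp add: H_def mat_mult_nth K_def cmat_of_real_def Im_mat_def)
    have "X - H = cmat_of_real V - Ji"
      by (simp add: vec_eq_iff X_def H_nth cmat_of_real_def complex_eq_iff)
    then have minus: "psd_mat (X - H)" using psd by simp
    have "X + H = (\<chi> i j. cnj ((cmat_of_real V - Ji) $ i $ j))"
      by (simp add: vec_eq_iff X_def H_nth cmat_of_real_def complex_eq_iff)
    then have plus: "psd_mat (X + H)" using psd_mat_conj[OF psd] by simp
    have H: "hermitian_mat H"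
    proof -
      have "cnj (H $ j $ i) = H $ i $ j" for i j
        using Ji_nth[of j i] by (simp add: H_nth)
      then show ?thesis by (simp add: hermitian_mat_def vec_eq_iff)
    qed
    have K: "K = mat (- \<i>) ** H"
    proof -
      have "mat (- \<i>) ** mat \<i> = (mat 1 :: complex^'m^'m)"
        by (simp add: vec_eq_iff mat_mult_nth) (simp add: mat_def)
      then show ?thesis by (simp add: H_def matrix_mul_assoc)
    qed
    \<comment> \<open>Because \<open>G\<close> is real, taking imaginary parts commutes with
      multiplication by \<open>G\<close>.\<close>
    have Im: "cmat_of_real (Im_mat (cmat_of_real G ** Ji)) = cmat_of_real G ** K"
      by (simp add: vec_eq_iff cmat_of_real_def Im_mat_def K_def matrix_matrix_mult_def)
    have "Spabs (Im_mat (cmat_of_real G ** Ji)) \<le> Re (trace (cmat_of_real G ** X))"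
      unfolding Spabs_def Let_def Im
      by (rule sum_abs_eigenvalues_le_trace[OF G_psd H K _ minus plus]) simp
    also have "\<dots> = trace (G ** V) - Re (trace (cmat_of_real G ** Ji))"
      unfolding X_def trace_GV Re_trace[of Ji] by (simp add: matrix_diff_ldistrib trace_sub)
    finally show ?thesis by (simp add: Ji_def)
  qed
  show ?thesis using SLD RLD by (simp add: V_def JS_def JR_def)
qed

end
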